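(* Let $\mathbb{P}$ be a weakly endowed forcing notion. Then forcing with $\mathbb{P}$ preserves each of the following covering properties: (1) the Rothberger property; (2) the Menger property; (3) selective screenability. That is, if $\Phi$ is any one of these three properties and $(X,\tau)$ is any topological space satisfying $\Phi$, then $\Vdash_{\mathbb{P}}$ "$(\check{X},\tau^{\mathbb{P}})$ satisfies $\Phi$".
   Context: Forcing convention: $r\le p$ means $r$ is a stronger condition than $p$; $p,q\in\mathbb{P}$ are compatible if they have a common lower bound in $\mathbb{P}$; an antichain is a set of pairwise incompatible conditions. Weakly endowed: a forcing notion $\mathbb{P}$ is weakly endowed if there are a decomposition $\mathbb{P}=\bigcup_{n<\omega}P_n$ with $P_n\subseteq P_{n+1}$ for all $n$, and a sequence $\langle\mathcal{L}_n : n<\omega\rangle$ of sets such that for each $n<\omega$: (i) $\mathcal{L}_n$ is a set of finite antichains in $\mathbb{P}$; (ii) for every maximal antichain $A$ in $\mathbb{P}$ there is $L\in\mathcal{L}_n$ with $L\subseteq A$; (iii) for any $p\in P_n$ and $L\in\mathcal{L}_n$ there is $q\in L$ such that $p,q$ are compatible in $\mathbb{P}$. The space in the extension: for a topological space $(X,\tau)$ in the ground model, $\tau$ remains a base of a topology on $X$ in the forcing extension by $\mathbb{P}$; $\tau^{\mathbb{P}}$ denotes a $\mathbb{P}$-name for the topology on $\check{X}$ generated by $\tau$. A family $\mathcal{A}$ of open sets refines a family $\mathcal{B}$ of open sets if for each $U\in\mathcal{A}$ there is $V\in\mathcal{B}$ with $U\subseteq V$ (neither family is required to be a cover). Rothberger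 property of a space: for every sequence $\langle\mathcal{U}_n : n<\omega\rangle$ of open covers there is a sequence $\langle U_n : n<\omega\rangle$ of open sets such that $U_n\in\mathcal{U}_n$ for all $n$ and $\{U_n : n<\omega\}$ is an open cover of the space. Menger property: for every sequence $\langle\mathcal{U}_n : n<\omega\rangle$ of open covers there is a sequence $\langle\mathcal{F}_n : n<\omega\rangle$ such that each $\mathcal{F}_n$ is a finite subset of $\mathcal{U}_n$ and $\bigcup_{n<\omega}\mathcal{F}_n$ is an open cover of the space. Selective screenability: for every sequence $\langle\mathcal{U}_n : n<\omega\rangle$ of open covers there is a sequence $\langle\mathcal{H}_n : n<\omega\rangle$ of sets of open sets such that each $\mathcal{H}_n$ is pairwise disjoint and refines $\mathcal{U}_n$, and $\bigcup_{n<\omega}\mathcal{H}_n$ is an open cover of the space. No separation axioms are assumed on topological spaces. *)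

theory Defs
  imports "HOL-Analysis.Analysis"
begin

section \<open>Weakly endowed forcing notions\<close>

text \<open>A forcing notion is a type of class \<open>preorder\<close>; \<open>r \<le> p\<close> means that \<open>r\<close> is the
  stronger condition. Neither antisymmetry nor a largest condition is required.\<close>

definition compatible :: "'p::preorder \<Rightarrow> 'p \<Rightarrow> bool" where
  "compatible p q \<longleftrightarrow> (\<exists>r. r \<le> p \<and> r \<le> q)"

definition antichain :: "'p::preorder set \<Rightarrow> bool" where
  "antichain A \<longleftrightarrow> pairwise (\<lambda>p q. \<not> compatible p q) A"

definition maximal_antichain :: "'p::preorder set \<Rightarrow> bool" where
  "maximal_antichain A \<longleftrightarrow> antichain A \<and> (\<forall>B. antichain B \<and> A \<subseteq> B \<longrightarrow> B = A)"

definition weakly_endowed :: "'p::preorder itself \<Rightarrow> bool" where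
  "weakly_endowed _ \<longleftrightarrow>
     (\<exists>(P :: nat \<Rightarrow> 'p set) (\<L> :: nat \<Rightarrow> 'p set set).
        (\<Union>n. P n) = UNIV \<and> (\<forall>n. P n \<subseteq> P (Suc n)) \<and>
        (\<forall>n. (\<forall>L\<in>\<L> n. finite L \<and> antichain L) \<and>
             (\<forall>A. maximal_antichain A \<longrightarrow> (\<exists>L\<in>\<L> n. L \<subseteq> A)) \<and>
             (\<forall>p\<in>P n. \<forall>L\<in>\<L> n. \<exists>q\<in>L. compatible p q)))"


section \<open>Covering properties in the ground model\<close>

definition open_cover :: "'a topology \<Rightarrow> 'a set set \<Rightarrow> bool" where
  "open_cover X \<U> \<longleftrightarrow> (\<forall>U\<in>\<U>. openin X U) \<and> \<Union>\<U> = topspace X"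

definition refines :: "'a set set \<Rightarrow> 'a set set \<Rightarrow> bool" where
  "refines \<A> \<B> \<longleftrightarrow> (\<forall>U\<in>\<A>. \<exists>V\<in>\<B>. U \<subseteq> V)"

definition rothberger :: "'a topology \<Rightarrow> bool" where
  "rothberger X \<longleftrightarrow>
     (\<forall>\<U> :: nat \<Rightarrow> 'a set set. (\<forall>n. open_cover X (\<U> n)) \<longrightarrow>
        (\<exists>U :: nat \<Rightarrow> 'a set. (\<forall>n. U n \<in> \<U> n) \<and> open_cover X (range U)))"

definition menger :: "'a topology \<Rightarrow> bool" where
  "menger X \<longleftrightarrow>
     (\<forall>\<U> :: nat \<Rightarrow> 'a set set. (\<forall>n. open_cover X (\<U> n)) \<longrightarrow>
        (\<exists>\<F> :: nat \<Rightarrow> 'a set set. (\<forall>n. finite (\<F> n) \<and> \<F> n \<subseteq> \<U> n) \<and> open_cover X (\<Union>n. \<F> n)))"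

definition selectively_screenable :: "'a topology \<Rightarrow> bool" where
  "selectively_screenable X \<longleftrightarrow>
     (\<forall>\<U> :: nat \<Rightarrow> 'a set set. (\<forall>n. open_cover X (\<U> n)) \<longrightarrow>
        (\<exists>\<H> :: nat \<Rightarrow> 'a set set.
           (\<forall>n. (\<forall>U\<in>\<H> n. openin X U) \<and> pairwise disjnt (\<H> n) \<and> refines (\<H> n) (\<U> n)) \<and>
           open_cover X (\<Union>n. \<H> n)))"


section \<open>Names and the forcing relation\<close>

text \<open>The ground model is the universe of HOL, so names are typed by the rank of the object they
  name. A name for a set is, as usual, a set of pairs of a name for a potential element and a
  condition. At the bottom of the hierarchy are the points of the ground space and the natural
  numbers: a ground element \<open>x\<close> serves as its own check name. Ordered pairs of names stand for the
  canonical names for ordered pairs.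

  A formula of the forcing language is represented by the predicate ``\<open>p\<close> forces it'', given by
  the usual recursion. Negation, conjunction and universal quantification over names are
  primitive, the other connectives are the classical abbreviations.\<close>

type_synonym ('n, 'p) name = "('n \<times> 'p) set"
type_synonym ('a, 'p) set_name = "('a, 'p) name"
type_synonym ('a, 'p) family_name = "(('a, 'p) name, 'p) name"
type_synonym ('n, 'p) seq_name = "(nat \<times> 'n, 'p) name"
type_synonym 'p formula = "'p \<Rightarrow> bool"

definition forced :: "'p::preorder formula \<Rightarrow> bool" ("\<tturnstile> _" [5] 5) where
  "(\<tturnstile> \<phi>) \<longleftrightarrow> (\<forall>p. \<phi> p)"

definition f_not :: "'p::preorder formula \<Rightarrow> 'p formula" ("\<^bold>\<not> _" [40] 40) where
  "(\<^bold>\<not> \<phi>) = (\<lambda>p. \<forall>q\<le>p. \<not> \<phi> q)"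

definition f_and :: "'p::preorder formula \<Rightarrow> 'p formula \<Rightarrow> 'p formula" (infixr "\<^bold>\<and>" 35) where
  "(\<phi> \<^bold>\<and> \<psi>) = (\<lambda>p. \<phi> p \<and> \<psi> p)"

definition f_all :: "('n \<Rightarrow> 'p::preorder formula) \<Rightarrow> 'p formula" (binder "\<^bold>\<forall>" 10) where
  "(\<^bold>\<forall>x. \<phi> x) = (\<lambda>p. \<forall>x. \<phi> x p)"

definition f_imp :: "'p::preorder formula \<Rightarrow> 'p formula \<Rightarrow> 'p formula" (infixr "\<^bold>\<longrightarrow>" 25) where
  "(\<phi> \<^bold>\<longrightarrow> \<psi>) = (\<^bold>\<not> (\<phi> \<^bold>\<and> \<^bold>\<not> \<psi>))"

definition f_iff :: "'p::preorder formula \<Rightarrow> 'p formula \<Rightarrow> 'p formula" (infixr "\<^bold>\<longleftrightarrow>" 25) where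
  "(\<phi> \<^bold>\<longleftrightarrow> \<psi>) = ((\<phi> \<^bold>\<longrightarrow> \<psi>) \<^bold>\<and> (\<psi> \<^bold>\<longrightarrow> \<phi>))"

definition f_ex :: "('n \<Rightarrow> 'p::preorder formula) \<Rightarrow> 'p formula" (binder "\<^bold>\<exists>" 10) where
  "(\<^bold>\<exists>x. \<phi> x) = (\<^bold>\<not> (\<^bold>\<forall>x. \<^bold>\<not> \<phi> x))"

text \<open>Atomic formulas. The usual simultaneous recursion for equality and membership is unfolded
  along the type hierarchy: \<open>f_mem E\<close> and \<open>f_set_eq E\<close> are membership in, and equality of, names
  for sets whose elements are compared by \<open>E\<close>.\<close>

definition f_check_eq :: "'a \<Rightarrow> 'a \<Rightarrow> 'p::preorder formula" where
  "f_check_eq x y = (\<lambda>p. x = y)"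

definition f_pair_eq ::
  "('m \<Rightarrow> 'm \<Rightarrow> 'p::preorder formula) \<Rightarrow> ('n \<Rightarrow> 'n \<Rightarrow> 'p formula) \<Rightarrow>
   'm \<times> 'n \<Rightarrow> 'm \<times> 'n \<Rightarrow> 'p formula" where
  "f_pair_eq E F x y = (E (fst x) (fst y) \<^bold>\<and> F (snd x) (snd y))"

definition f_mem ::
  "('n \<Rightarrow> 'n \<Rightarrow> 'p::preorder formula) \<Rightarrow> 'n \<Rightarrow> ('n, 'p) name \<Rightarrow> 'p formula" where
  "f_mem E x A = (\<lambda>p. \<forall>q\<le>p. \<exists>r\<le>q. \<exists>(y, s)\<in>A. r \<le> s \<and> E x y r)"

definition f_set_eq ::
  "('n \<Rightarrow> 'n \<Rightarrow> 'p::preorder formula) \<Rightarrow> ('n, 'p) name \<Rightarrow> ('n, 'p) name \<Rightarrow> 'p formula" where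
  "f_set_eq E A B = (\<lambda>p. (\<forall>(x, s)\<in>A. \<forall>q. q \<le> p \<and> q \<le> s \<longrightarrow> f_mem E x B q) \<and>
                         (\<forall>(x, s)\<in>B. \<forall>q. q \<le> p \<and> q \<le> s \<longrightarrow> f_mem E x A q))"

text \<open>Subscript 0 compares points (or natural numbers) and subscript 1 compares sets of points.\<close>

abbreviation f_eq0 :: "'a \<Rightarrow> 'a \<Rightarrow> 'p::preorder formula" (infix "\<^bold>=\<^sub>0" 50) where
  "x \<^bold>=\<^sub>0 y \<equiv> f_check_eq x y"

abbreviation f_eq1 ::
  "('a, 'p::preorder) set_name \<Rightarrow> ('a, 'p) set_name \<Rightarrow> 'p formula" (infix "\<^bold>=\<^sub>1" 50) where
  "A \<^bold>=\<^sub>1 B \<equiv> f_set_eq f_eq0 A B"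

abbreviation f_eq2 ::
  "('a, 'p::preorder) family_name \<Rightarrow> ('a, 'p) family_name \<Rightarrow> 'p formula" (infix "\<^bold>=\<^sub>2" 50) where
  "\<A> \<^bold>=\<^sub>2 \<B> \<equiv> f_set_eq f_eq1 \<A> \<B>"

abbreviation f_mem0 :: "'a \<Rightarrow> ('a, 'p::preorder) set_name \<Rightarrow> 'p formula" (infix "\<^bold>\<in>\<^sub>0" 50) where
  "x \<^bold>\<in>\<^sub>0 A \<equiv> f_mem f_eq0 x A"

abbreviation f_mem1 ::
  "('a, 'p::preorder) set_name \<Rightarrow> ('a, 'p) family_name \<Rightarrow> 'p formula" (infix "\<^bold>\<in>\<^sub>1" 50) where
  "A \<^bold>\<in>\<^sub>1 \<A> \<equiv> f_mem f_eq1 A \<A>"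

definition check :: "'a set \<Rightarrow> ('a, 'p::preorder) set_name" where
  "check A = A \<times> UNIV"

definition check_family :: "'a set set \<Rightarrow> ('a, 'p::preorder) family_name" where
  "check_family \<A> = (check ` \<A>) \<times> UNIV"


section \<open>Covering properties in the forcing language\<close>

definition f_subset :: "('a, 'p::preorder) set_name \<Rightarrow> ('a, 'p) set_name \<Rightarrow> 'p formula"
    (infix "\<^bold>\<subseteq>" 50) where
  "(A \<^bold>\<subseteq> B) = (\<^bold>\<forall>x. x \<^bold>\<in>\<^sub>0 A \<^bold>\<longrightarrow> x \<^bold>\<in>\<^sub>0 B)"

text \<open>The name for the topology generated by the base \<open>\<tau>\<close>, the ground model topology of \<open>X\<close>:
  its elements are the sets that contain a basic neighbourhood of each of their points.\<close>

definition generated_topology :: "'a topology \<Rightarrow> ('a, 'p::preorder) family_name" where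
  "generated_topology X =
     {(U, p). (\<^bold>\<forall>x. x \<^bold>\<in>\<^sub>0 U \<^bold>\<longrightarrow>
        (\<^bold>\<exists>V. V \<^bold>\<in>\<^sub>1 check_family {W. openin X W} \<^bold>\<and> x \<^bold>\<in>\<^sub>0 V \<^bold>\<and> V \<^bold>\<subseteq> U)) p}"

text \<open>\<open>f_value E S n y\<close> says that the sequence \<open>S\<close> has value \<open>y\<close> at \<open>n\<close>, where values are compared
  by \<open>E\<close>. A sequence is a set of pairs that is a function with domain \<open>\<omega>\<close>.\<close>

definition f_value ::
  "('n \<Rightarrow> 'n \<Rightarrow> 'p::preorder formula) \<Rightarrow> ('n, 'p) seq_name \<Rightarrow> nat \<Rightarrow> 'n \<Rightarrow> 'p formula" where
  "f_value E S n y = f_mem (f_pair_eq f_eq0 E) (n, y) S"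

abbreviation f_value1 ::
  "(('a, 'p::preorder) set_name, 'p) seq_name \<Rightarrow> nat \<Rightarrow> ('a, 'p) set_name \<Rightarrow> 'p formula" where
  "f_value1 \<equiv> f_value f_eq1"

abbreviation f_value2 ::
  "(('a, 'p::preorder) family_name, 'p) seq_name \<Rightarrow> nat \<Rightarrow> ('a, 'p) family_name \<Rightarrow> 'p formula" where
  "f_value2 \<equiv> f_value f_eq2"

definition f_sequence ::
  "('n \<Rightarrow> 'n \<Rightarrow> 'p::preorder formula) \<Rightarrow> ('n, 'p) seq_name \<Rightarrow> 'p formula" where
  "f_sequence E S =
     ((\<^bold>\<forall>n. \<^bold>\<exists>y. f_value E S n y) \<^bold>\<and>
      (\<^bold>\<forall>n. \<^bold>\<forall>y. \<^bold>\<forall>z. f_value E S n y \<^bold>\<and> f_value E S n z \<^bold>\<longrightarrow> E y z))"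

text \<open>\<open>f\<close> is a bijection from the natural number \<open>k = {0, \<dots>, k - 1}\<close> onto the family \<open>\<F>\<close>.\<close>

definition f_enumerates ::
  "(('a, 'p::preorder) set_name, 'p) seq_name \<Rightarrow> nat \<Rightarrow> ('a, 'p) family_name \<Rightarrow> 'p formula" where
  "f_enumerates f k \<F> =
     ((\<^bold>\<forall>n. \<^bold>\<forall>U. f_value1 f n U \<^bold>\<longrightarrow> n \<^bold>\<in>\<^sub>0 check {..<k} \<^bold>\<and> U \<^bold>\<in>\<^sub>1 \<F>) \<^bold>\<and>
      (\<^bold>\<forall>n. n \<^bold>\<in>\<^sub>0 check {..<k} \<^bold>\<longrightarrow> (\<^bold>\<exists>U. f_value1 f n U)) \<^bold>\<and>
      (\<^bold>\<forall>n. \<^bold>\<forall>U. \<^bold>\<forall>V. f_value1 f n U \<^bold>\<and> f_value1 f n V \<^bold>\<longrightarrow> U \<^bold>=\<^sub>1 V) \<^bold>\<and>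
      (\<^bold>\<forall>m. \<^bold>\<forall>n. \<^bold>\<forall>U. f_value1 f m U \<^bold>\<and> f_value1 f n U \<^bold>\<longrightarrow> m \<^bold>=\<^sub>0 n) \<^bold>\<and>
      (\<^bold>\<forall>U. U \<^bold>\<in>\<^sub>1 \<F> \<^bold>\<longrightarrow> (\<^bold>\<exists>n. f_value1 f n U)))"

definition f_finite :: "('a, 'p::preorder) family_name \<Rightarrow> 'p formula" where
  "f_finite \<F> = (\<^bold>\<exists>k. \<^bold>\<exists>f. f_enumerates f k \<F>)"

definition f_subfamily ::
  "('a, 'p::preorder) family_name \<Rightarrow> ('a, 'p) family_name \<Rightarrow> 'p formula" where
  "f_subfamily \<A> \<B> = (\<^bold>\<forall>U. U \<^bold>\<in>\<^sub>1 \<A> \<^bold>\<longrightarrow> U \<^bold>\<in>\<^sub>1 \<B>)"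

definition f_pairwise_disjoint :: "('a, 'p::preorder) family_name \<Rightarrow> 'p formula" where
  "f_pairwise_disjoint \<H> =
     (\<^bold>\<forall>U. \<^bold>\<forall>V. U \<^bold>\<in>\<^sub>1 \<H> \<^bold>\<and> V \<^bold>\<in>\<^sub>1 \<H> \<^bold>\<and> \<^bold>\<not> U \<^bold>=\<^sub>1 V \<^bold>\<longrightarrow> \<^bold>\<not> (\<^bold>\<exists>x. x \<^bold>\<in>\<^sub>0 U \<^bold>\<and> x \<^bold>\<in>\<^sub>0 V))"

definition f_refines ::
  "('a, 'p::preorder) family_name \<Rightarrow> ('a, 'p) family_name \<Rightarrow> 'p formula" where
  "f_refines \<A> \<B> = (\<^bold>\<forall>U. U \<^bold>\<in>\<^sub>1 \<A> \<^bold>\<longrightarrow> (\<^bold>\<exists>V. V \<^bold>\<in>\<^sub>1 \<B> \<^bold>\<and> U \<^bold>\<subseteq> V))"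

text \<open>\<open>f_open_cover X T C\<close> says that \<open>{U. C U}\<close> is an open cover of the space \<open>(X, T)\<close>. The family is
  given by a formula rather than a name, so that it can be instantiated with the range
  or the union of a sequence.\<close>

definition f_open_cover ::
  "('a, 'p::preorder) set_name \<Rightarrow> ('a, 'p) family_name \<Rightarrow> (('a, 'p) set_name \<Rightarrow> 'p formula) \<Rightarrow>
   'p formula" where
  "f_open_cover X T C =
     ((\<^bold>\<forall>U. C U \<^bold>\<longrightarrow> U \<^bold>\<in>\<^sub>1 T) \<^bold>\<and> (\<^bold>\<forall>x. (\<^bold>\<exists>U. C U \<^bold>\<and> x \<^bold>\<in>\<^sub>0 U) \<^bold>\<longleftrightarrow> x \<^bold>\<in>\<^sub>0 X))"

definition f_sequence_of_open_covers ::
  "('a, 'p::preorder) set_name \<Rightarrow> ('a, 'p) family_name \<Rightarrow> (('a, 'p) family_name, 'p) seq_name \<Rightarrow>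
   'p formula" where
  "f_sequence_of_open_covers X T \<U> =
     (f_sequence f_eq2 \<U> \<^bold>\<and>
      (\<^bold>\<forall>n. \<^bold>\<forall>\<A>. f_value2 \<U> n \<A> \<^bold>\<longrightarrow> f_open_cover X T (\<lambda>U. U \<^bold>\<in>\<^sub>1 \<A>)))"

definition f_rothberger ::
  "('a, 'p::preorder) set_name \<Rightarrow> ('a, 'p) family_name \<Rightarrow> 'p formula" where
  "f_rothberger X T =
     (\<^bold>\<forall>\<U>. f_sequence_of_open_covers X T \<U> \<^bold>\<longrightarrow>
       (\<^bold>\<exists>S. f_sequence f_eq1 S \<^bold>\<and>
             (\<^bold>\<forall>n. \<^bold>\<forall>\<A>. \<^bold>\<forall>U. f_value2 \<U> n \<A> \<^bold>\<and> f_value1 S n U \<^bold>\<longrightarrow> U \<^bold>\<in>\<^sub>1 \<A>) \<^bold>\<and>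
             f_open_cover X T (\<lambda>U. \<^bold>\<exists>n. f_value1 S n U)))"

definition f_menger ::
  "('a, 'p::preorder) set_name \<Rightarrow> ('a, 'p) family_name \<Rightarrow> 'p formula" where
  "f_menger X T =
     (\<^bold>\<forall>\<U>. f_sequence_of_open_covers X T \<U> \<^bold>\<longrightarrow>
       (\<^bold>\<exists>S. f_sequence f_eq2 S \<^bold>\<and>
             (\<^bold>\<forall>n. \<^bold>\<forall>\<A>. \<^bold>\<forall>\<F>. f_value2 \<U> n \<A> \<^bold>\<and> f_value2 S n \<F> \<^bold>\<longrightarrow>
                f_finite \<F> \<^bold>\<and> f_subfamily \<F> \<A>) \<^bold>\<and>
             f_open_cover X T (\<lambda>U. \<^bold>\<exists>n. \<^bold>\<exists>\<F>. f_value2 S n \<F> \<^bold>\<and> U \<^bold>\<in>\<^sub>1 \<F>)))"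

definition f_selectively_screenable ::
  "('a, 'p::preorder) set_name \<Rightarrow> ('a, 'p) family_name \<Rightarrow> 'p formula" where
  "f_selectively_screenable X T =
     (\<^bold>\<forall>\<U>. f_sequence_of_open_covers X T \<U> \<^bold>\<longrightarrow>
       (\<^bold>\<exists>S. f_sequence f_eq2 S \<^bold>\<and>
             (\<^bold>\<forall>n. \<^bold>\<forall>\<A>. \<^bold>\<forall>\<H>. f_value2 \<U> n \<A> \<^bold>\<and> f_value2 S n \<H> \<^bold>\<longrightarrow>
                f_subfamily \<H> T \<^bold>\<and> f_pairwise_disjoint \<H> \<^bold>\<and> f_refines \<H> \<A>) \<^bold>\<and>
             f_open_cover X T (\<lambda>U. \<^bold>\<exists>n. \<^bold>\<exists>\<H>. f_value2 S n \<H> \<^bold>\<and> U \<^bold>\<in>\<^sub>1 \<H>)))"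

end

theory Submission
  imports Defs
begin

text \<open>Fix a condition \<open>p\<close> that forces \<open>\<U>\<close> to be a sequence of open covers. In the
extension every point \<open>x\<close> lies in some member of the \<open>n\<close>th cover, hence some ground model
neighbourhood of \<open>x\<close> is contained in such a member; call a ground model open set captured (at \<open>n\<close>)
if a member of the \<open>n\<close>th cover contains it. Thus, for each \<open>x\<close>, the conditions deciding a captured
neighbourhood of \<open>x\<close> are dense below \<open>p\<close>. A maximal antichain of them contains a finite set \<open>L\<close> from
the \<open>n\<close>th family of antichains in the weak endowment, and the intersection of the finitely many
neighbourhoods attached to the elements of \<open>L\<close> is one neighbourhood that all of \<open>L\<close> force to be
captured. The open sets \<open>W\<close> arising in this way form, in the ground model, an open cover \<open>\<W> n\<close>.

Apply the selection principle to these covers in the ground model. Each \<open>r \<le> p\<close> belongs to the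
\<open>m\<close>th piece of the endowment for some \<open>m\<close>, hence to all later pieces, so for \<open>n \<ge> m\<close> it is
compatible with an element of the \<open>L\<close> belonging to any given \<open>W \<in> \<W> n\<close>: some extension of \<open>r\<close>
forces \<open>W\<close> to be captured. The selection therefore has to cover each point at arbitrarily late
stages. This is arranged by splitting \<open>\<omega>\<close> into infinitely many infinite columns and selecting a
cover along each of them (\<open>captured_selection\<close>).

It remains to turn the selected ground model sets into a selection in the extension
(\<open>selection_forced\<close>). For the Rothberger property one picks a member of the \<open>n\<close>th cover containing
the selected set if that set is captured, and any member otherwise. For the Menger property one picks
such members for those of the finitely many selected sets that are captured. For selective screenability one keeps the selected sets
that are captured. In each case a density argument shows that every point gets covered. The names
for the new sequences are mixed along antichains (\<open>sequence_choice\<close>).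

All three arguments use a fragment of forcing calculus: a formula of the forcing language is forced
by \<open>p\<close> if it is forced densely below \<open>p\<close>, and implication and existential quantification then behave
as in Kripke semantics, up to density.\<close>

section \<open>Reasoning inside the forcing relation\<close>

text \<open>Regularity says that the set of conditions forcing \<open>\<phi>\<close> is a regular open set in the order
topology, that is, an element of the Boolean completion. Closure of the regular predicates under the
connectives and the atomic formulas is what makes the classical abbreviations for implication and
existence behave as expected.\<close>
definition regular :: "'p::preorder formula \<Rightarrow> bool" where
  "regular \<phi> \<longleftrightarrow> (\<forall>p. \<phi> p \<longleftrightarrow> (\<forall>q\<le>p. \<exists>r\<le>q. \<phi> r))"

lemma regularI:
  assumes "\<And>p q. \<phi> p \<Longrightarrow> q \<le> p \<Longrightarrow> \<phi> q"
    and "\<And>p. (\<And>q. q \<le> p \<Longrightarrow> \<exists>r\<le>q. \<phi> r) \<Longrightarrow> \<phi> p"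
  shows "regular \<phi>"
  unfolding regular_def using assms by (meson order_refl)

lemma regular_mono: "regular \<phi> \<Longrightarrow> \<phi> p \<Longrightarrow> q \<le> p \<Longrightarrow> \<phi> q"
  unfolding regular_def by (meson order_trans)

lemma regular_dense: "regular \<phi> \<Longrightarrow> (\<And>q. q \<le> p \<Longrightarrow> \<exists>r\<le>q. \<phi> r) \<Longrightarrow> \<phi> p"
  unfolding regular_def by blast

lemma regular_const: "regular (\<lambda>_. b)"
  unfolding regular_def by (meson order_refl)

lemma regular_not: "regular \<phi> \<Longrightarrow> regular (\<^bold>\<not> \<phi>)"
  by (rule regularI; unfold f_not_def) (meson order_trans order_refl regular_mono)+

lemma regular_and:
  assumes "regular \<phi>" "regular \<psi>"
  shows "regular (\<phi> \<^bold>\<and> \<psi>)"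
proof (rule regularI; unfold f_and_def)
  show "\<phi> q \<and> \<psi> q" if "\<phi> p \<and> \<psi> p" "q \<le> p" for p q
    using that assms regular_mono by blast
  show "\<phi> p \<and> \<psi> p" if "\<And>q. q \<le> p \<Longrightarrow> \<exists>r\<le>q. \<phi> r \<and> \<psi> r" for p
    using that regular_dense[OF assms(1)] regular_dense[OF assms(2)] by blast
qed

lemma regular_all:
  assumes "\<And>x. regular (\<phi> x)"
  shows "regular (\<^bold>\<forall>x. \<phi> x)"
proof (rule regularI; unfold f_all_def)
  show "\<forall>x. \<phi> x q" if "\<forall>x. \<phi> x p" "q \<le> p" for p q
    using that assms regular_mono by blast
  show "\<forall>x. \<phi> x p" if "\<And>q. q \<le> p \<Longrightarrow> \<exists>r\<le>q. \<forall>x. \<phi> x r" for p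
    using that regular_dense[OF assms] by blast
qed

lemma regular_imp: "regular \<phi> \<Longrightarrow> regular \<psi> \<Longrightarrow> regular (\<phi> \<^bold>\<longrightarrow> \<psi>)"
  unfolding f_imp_def by (intro regular_not regular_and)

lemma regular_iff: "regular \<phi> \<Longrightarrow> regular \<psi> \<Longrightarrow> regular (\<phi> \<^bold>\<longleftrightarrow> \<psi>)"
  unfolding f_iff_def by (intro regular_imp regular_and)

lemma regular_ex: "(\<And>x. regular (\<phi> x)) \<Longrightarrow> regular (\<^bold>\<exists>x. \<phi> x)"
  unfolding f_ex_def by (intro regular_not regular_all)

lemma regular_check_eq: "regular (f_check_eq x y)"
  unfolding f_check_eq_def by (rule regular_const)

lemma regular_pair_eq:
  "(\<And>x y. regular (E x y)) \<Longrightarrow> (\<And>x y. regular (F x y)) \<Longrightarrow> regular (f_pair_eq E F x y)"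
  unfolding f_pair_eq_def by (intro regular_and)

lemma regular_mem: "regular (f_mem E x A)"
  by (rule regularI; unfold f_mem_def) (meson order_trans order_refl)+

lemma forces_set_eq_iff:
  "f_set_eq E A B p \<longleftrightarrow>
     (\<forall>x s q. (x, s) \<in> A \<longrightarrow> q \<le> p \<longrightarrow> q \<le> s \<longrightarrow> f_mem E x B q) \<and>
     (\<forall>x s q. (x, s) \<in> B \<longrightarrow> q \<le> p \<longrightarrow> q \<le> s \<longrightarrow> f_mem E x A q)"
  unfolding f_set_eq_def by auto

lemma set_eq_sym: "f_set_eq E A B p \<Longrightarrow> f_set_eq E B A p"
  unfolding forces_set_eq_iff by blast

lemma regular_set_eq: "regular (f_set_eq E A B)"
proof (rule regularI)
  show "f_set_eq E A B q" if "f_set_eq E A B p" "q \<le> p" for p q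
    using that order_trans[of _ q p] unfolding forces_set_eq_iff by blast
next
  fix p assume dense: "\<And>q. q \<le> p \<Longrightarrow> \<exists>r\<le>q. f_set_eq E A B r"
  have half: "f_mem E x D q"
    if eq: "\<And>r. f_set_eq E A B r \<Longrightarrow> f_set_eq E C D r"
      and *: "(x, s) \<in> C" "q \<le> p" "q \<le> s" for C D x s q
  proof (rule regular_dense[OF regular_mem])
    fix q' assume q': "q' \<le> q"
    then have "q' \<le> p"
      using * order_trans by blast
    then obtain r where r: "r \<le> q'" "f_set_eq E C D r"
      using dense eq by blast
    moreover have "r \<le> s"
      using r q' * order_trans by blast
    ultimately have "f_mem E x D r"
      using * unfolding forces_set_eq_iff by blast
    then show "\<exists>r\<le>q'. f_mem E x D r"
      using r by blast
  qed
  show "f_set_eq E A B p"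
    unfolding forces_set_eq_iff
    using half[of A B] half[of B A, OF set_eq_sym] by blast
qed

lemma regular_value: "regular (f_value E S n y)"
  unfolding f_value_def by (rule regular_mem)

lemma regular_subset: "regular (A \<^bold>\<subseteq> B)"
  unfolding f_subset_def by (intro regular_all regular_imp regular_mem)

lemmas regular_intros =
  regular_not regular_and regular_all regular_imp regular_iff regular_ex regular_check_eq
  regular_pair_eq regular_mem regular_set_eq regular_value regular_subset

lemma regular_sequence: "(\<And>x y. regular (E x y)) \<Longrightarrow> regular (f_sequence E S)"
  unfolding f_sequence_def by (intro regular_intros)

lemma regular_finite: "regular (f_finite \<F>)"
  unfolding f_finite_def f_enumerates_def by (intro regular_intros)

lemma regular_subfamily: "regular (f_subfamily \<A> \<B>)"
  unfolding f_subfamily_def by (intro regular_intros)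

lemma regular_pairwise_disjoint: "regular (f_pairwise_disjoint \<A>)"
  unfolding f_pairwise_disjoint_def by (intro regular_intros)

lemma regular_refines: "regular (f_refines \<A> \<B>)"
  unfolding f_refines_def by (intro regular_intros)

lemma regular_open_cover: "(\<And>U. regular (C U)) \<Longrightarrow> regular (f_open_cover X T C)"
  unfolding f_open_cover_def by (intro regular_intros)

lemma regular_sequence_of_open_covers: "regular (f_sequence_of_open_covers X T \<U>)"
  unfolding f_sequence_of_open_covers_def
  by (intro regular_intros regular_sequence regular_open_cover)

lemmas regular_concept_intros = regular_intros regular_sequence regular_finite
  regular_subfamily regular_pairwise_disjoint regular_refines regular_open_cover
  regular_sequence_of_open_covers

lemma forces_and: "(\<phi> \<^bold>\<and> \<psi>) p \<longleftrightarrow> \<phi> p \<and> \<psi> p"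
  unfolding f_and_def ..

lemma forces_all: "(\<^bold>\<forall>x. \<phi> x) p \<longleftrightarrow> (\<forall>x. \<phi> x p)"
  unfolding f_all_def ..

lemma forces_andI: "\<phi> p \<Longrightarrow> \<psi> p \<Longrightarrow> (\<phi> \<^bold>\<and> \<psi>) p"
  unfolding forces_and ..

lemma forces_allI: "(\<And>x. \<phi> x p) \<Longrightarrow> (\<^bold>\<forall>x. \<phi> x) p"
  unfolding forces_all by blast

lemma forces_allD: "(\<^bold>\<forall>x. \<phi> x) p \<Longrightarrow> \<phi> x p"
  unfolding forces_all by blast

lemma forces_impI: "(\<And>q. q \<le> p \<Longrightarrow> \<phi> q \<Longrightarrow> \<psi> q) \<Longrightarrow> (\<phi> \<^bold>\<longrightarrow> \<psi>) p"
  unfolding f_imp_def f_not_def f_and_def by (meson order_refl)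

text \<open>Implication abbreviates \<open>\<not>(\<phi> \<and> \<not>\<psi>)\<close>, which only yields \<open>\<psi>\<close> densely below the condition; regularity
of \<open>\<psi>\<close> removes the double negation.\<close>
lemma forces_impD:
  assumes imp: "(\<phi> \<^bold>\<longrightarrow> \<psi>) p" and "\<phi> q" "q \<le> p" "regular \<phi>" "regular \<psi>"
  shows "\<psi> q"
proof (rule regular_dense[OF \<open>regular \<psi>\<close>])
  fix r assume r: "r \<le> q"
  then have "\<phi> r"
    using assms regular_mono by blast
  moreover have "r \<le> p"
    using r assms order_trans by blast
  ultimately show "\<exists>r'\<le>r. \<psi> r'"
    using imp unfolding f_imp_def f_not_def f_and_def by blast
qed

lemma forces_exI: "\<phi> x p \<Longrightarrow> regular (\<phi> x) \<Longrightarrow> (\<^bold>\<exists>x. \<phi> x) p"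
  unfolding f_ex_def f_not_def f_all_def by (meson order_refl regular_mono)

lemma forces_exD: "(\<^bold>\<exists>x. \<phi> x) p \<Longrightarrow> q \<le> p \<Longrightarrow> \<exists>r\<le>q. \<exists>x. \<phi> x r"
  unfolding f_ex_def f_not_def f_all_def by blast

lemma forces_memI:
  assumes "(y, s) \<in> A" "p \<le> s" "E x y p" "regular (E x y)"
  shows "f_mem E x A p"
  unfolding f_mem_def
proof (intro allI impI)
  fix q assume "q \<le> p"
  then have "q \<le> s" "E x y q"
    using assms order_trans regular_mono by blast+
  then show "\<exists>r\<le>q. \<exists>(y, s)\<in>A. r \<le> s \<and> E x y r"
    using assms(1) by (intro exI[of _ q]) auto
qed

lemma forces_memD: "f_mem E x A p \<Longrightarrow> q \<le> p \<Longrightarrow> \<exists>r\<le>q. \<exists>y s. (y, s) \<in> A \<and> r \<le> s \<and> E x y r"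
  unfolding f_mem_def by blast

lemma forces_memE:
  assumes "f_mem E x A p" "regular \<psi>"
    "\<And>q y s. q \<le> p \<Longrightarrow> (y, s) \<in> A \<Longrightarrow> q \<le> s \<Longrightarrow> E x y q \<Longrightarrow> \<psi> q"
  shows "\<psi> p"
proof (rule regular_dense[OF assms(2)])
  fix q assume q: "q \<le> p"
  then obtain r y s where r: "r \<le> q" "(y, s) \<in> A" "r \<le> s" "E x y r"
    using forces_memD[OF assms(1)] by blast
  then have "\<psi> r"
    using assms(3) q order_trans by blast
  then show "\<exists>r\<le>q. \<psi> r"
    using r by blast
qed

text \<open>The congruence laws for names are proved once for an arbitrary comparison of elements and then lifted
along the type hierarchy: the comparison of points satisfies these conditions, and they pass to
pairs and to sets.\<close>
definition equality :: "('n \<Rightarrow> 'n \<Rightarrow> 'p::preorder formula) \<Rightarrow> bool" where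
  "equality E \<longleftrightarrow> (\<forall>x y. regular (E x y)) \<and> (\<forall>p x. E x x p) \<and>
     (\<forall>p x y. E x y p \<longrightarrow> E y x p) \<and> (\<forall>p x y z. E x y p \<longrightarrow> E y z p \<longrightarrow> E x z p)"

lemma
  assumes "equality E"
  shows equality_regular: "regular (E x y)"
    and equality_refl: "E x x p"
    and equality_sym: "E x y p \<Longrightarrow> E y x p"
    and equality_trans: "E x y p \<Longrightarrow> E y z p \<Longrightarrow> E x z p"
  using assms unfolding equality_def by blast+

lemma mem_cong_left:
  assumes E: "equality E" and "E x y p" "f_mem E x A p"
  shows "f_mem E y A p"
  using assms(3) regular_mem
proof (rule forces_memE)
  fix q z s assume "q \<le> p" "(z, s) \<in> A" "q \<le> s" "E x z q"
  then show "f_mem E y A q"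
    using assms by (meson forces_memI equality_regular equality_sym equality_trans regular_mono)
qed

lemma mem_cong_right:
  assumes E: "equality E" and eq: "f_set_eq E A B p" and "f_mem E x A p"
  shows "f_mem E x B p"
  using assms(3) regular_mem
proof (rule forces_memE)
  fix q z s assume *: "q \<le> p" "(z, s) \<in> A" "q \<le> s" "E x z q"
  then have "f_mem E z B q"
    using eq unfolding forces_set_eq_iff by blast
  then show "f_mem E x B q"
    using * E mem_cong_left equality_sym by metis
qed

lemma set_eqI:
  assumes "equality E"
    "\<And>x q. q \<le> p \<Longrightarrow> f_mem E x A q \<Longrightarrow> f_mem E x B q"
    "\<And>x q. q \<le> p \<Longrightarrow> f_mem E x B q \<Longrightarrow> f_mem E x A q"
  shows "f_set_eq E A B p"
  unfolding forces_set_eq_iff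
  using assms(2,3) forces_memI[where E = E] equality_refl[OF assms(1)] equality_regular[OF assms(1)]
  by meson

lemma equality_set_eq:
  assumes E: "equality E"
  shows "equality (f_set_eq E)"
  unfolding equality_def
proof (intro conjI allI impI)
  show "f_set_eq E A C p" if "f_set_eq E A B p" "f_set_eq E B C p" for p A B C
    using E by (rule set_eqI)
      (meson that E mem_cong_right set_eq_sym regular_mono regular_set_eq)+
qed (use E set_eqI set_eq_sym regular_set_eq in auto)

lemma equality_check_eq: "equality f_check_eq"
  unfolding equality_def by (simp add: regular_check_eq) (simp add: f_check_eq_def)

lemma equality_pair_eq:
  assumes "equality E" "equality F"
  shows "equality (f_pair_eq E F)"
  unfolding equality_def
proof (intro conjI allI impI)
  show "regular (f_pair_eq E F x y)" for x y
    using assms by (simp add: regular_pair_eq equality_regular)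
qed (use assms in \<open>auto simp: f_pair_eq_def f_and_def
      intro: equality_refl equality_sym equality_trans\<close>)

lemmas equality1 = equality_set_eq[OF equality_check_eq]
lemmas equality2 = equality_set_eq[OF equality1]

lemma value_cong:
  assumes "equality E" "E y z p" "f_value E S n y p"
  shows "f_value E S n z p"
  using mem_cong_left[OF equality_pair_eq[OF equality_check_eq assms(1)]] assms(2,3)
  unfolding f_value_def f_pair_eq_def f_and_def f_check_eq_def by fastforce

lemma forces_mem_check: "(x \<^bold>\<in>\<^sub>0 check A) p \<longleftrightarrow> x \<in> A"
  unfolding f_mem_def check_def f_check_eq_def by (auto intro: order_refl)

lemma subsetD_forced: "(A \<^bold>\<subseteq> B) p \<Longrightarrow> (x \<^bold>\<in>\<^sub>0 A) q \<Longrightarrow> q \<le> p \<Longrightarrow> (x \<^bold>\<in>\<^sub>0 B) q"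
  unfolding f_subset_def forces_all by (meson forces_impD regular_mem)

lemma subsetI_forced: "(\<And>x q. q \<le> p \<Longrightarrow> (x \<^bold>\<in>\<^sub>0 A) q \<Longrightarrow> (x \<^bold>\<in>\<^sub>0 B) q) \<Longrightarrow> (A \<^bold>\<subseteq> B) p"
  unfolding f_subset_def forces_all by (blast intro: forces_impI)

lemma check_subset_check: "W \<subseteq> W' \<Longrightarrow> (check W \<^bold>\<subseteq> check W') p"
  by (rule subsetI_forced) (auto simp: forces_mem_check)

lemma subset_trans_forced: "(A \<^bold>\<subseteq> B) p \<Longrightarrow> (B \<^bold>\<subseteq> C) p \<Longrightarrow> (A \<^bold>\<subseteq> C) p"
  by (rule subsetI_forced) (meson subsetD_forced)

lemma subset_cong_right: "(A \<^bold>\<subseteq> B) p \<Longrightarrow> (B \<^bold>=\<^sub>1 C) p \<Longrightarrow> (A \<^bold>\<subseteq> C) p"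
  by (rule subsetI_forced)
    (meson subsetD_forced mem_cong_right equality_check_eq regular_mono regular_set_eq)

lemma subset_cong_left: "(A \<^bold>\<subseteq> B) p \<Longrightarrow> (A \<^bold>=\<^sub>1 C) p \<Longrightarrow> (C \<^bold>\<subseteq> B) p"
  by (rule subsetI_forced)
    (meson subsetD_forced mem_cong_right equality_check_eq regular_mono regular_set_eq set_eq_sym)

section \<open>The generated topology\<close>

lemma check_mem_generated_topology:
  assumes "openin X W"
  shows "(check W \<^bold>\<in>\<^sub>1 generated_topology X) p"
proof -
  have "(\<^bold>\<forall>x. x \<^bold>\<in>\<^sub>0 check W \<^bold>\<longrightarrow>
        (\<^bold>\<exists>V. V \<^bold>\<in>\<^sub>1 check_family {W. openin X W} \<^bold>\<and> x \<^bold>\<in>\<^sub>0 V \<^bold>\<and> V \<^bold>\<subseteq> check W)) p"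
    unfolding forces_all
  proof (intro allI forces_impI, rule forces_exI)
    fix x q assume "(x \<^bold>\<in>\<^sub>0 check W) q"
    moreover have "(check W \<^bold>\<in>\<^sub>1 check_family {W. openin X W}) q"
      using assms by (intro forces_memI[of _ q]) 
        (auto simp: check_family_def equality_refl[OF equality1] regular_set_eq)
    ultimately show "(check W \<^bold>\<in>\<^sub>1 check_family {W. openin X W} \<^bold>\<and> x \<^bold>\<in>\<^sub>0 check W
        \<^bold>\<and> check W \<^bold>\<subseteq> check W) q"
      by (simp add: forces_and check_subset_check)
  qed (intro regular_intros)
  then show ?thesis
    unfolding generated_topology_def
    by (intro forces_memI[of "check W" p])
      (auto simp: equality_refl[OF equality1] regular_set_eq)
qed

text \<open>The ground model topology is a base of the generated one: a point of an open set of the extension has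
a basic neighbourhood inside it, and below a suitable condition that neighbourhood is the check name
of a particular ground model open set.\<close>
lemma mem_generated_topologyD:
  assumes "(U \<^bold>\<in>\<^sub>1 generated_topology X) p" "(x \<^bold>\<in>\<^sub>0 U) p"
  shows "\<exists>r\<le>p. \<exists>W. openin X W \<and> x \<in> W \<and> (check W \<^bold>\<subseteq> U) r"
proof -
  obtain q U' s where q: "q \<le> p" "q \<le> s" "(U \<^bold>=\<^sub>1 U') q"
    and "(U', s) \<in> generated_topology X"
    using forces_memD[OF assms(1) order_refl] by blast
  then have U': "(\<^bold>\<forall>x. x \<^bold>\<in>\<^sub>0 U' \<^bold>\<longrightarrow>
      (\<^bold>\<exists>V. V \<^bold>\<in>\<^sub>1 check_family {W. openin X W} \<^bold>\<and> x \<^bold>\<in>\<^sub>0 V \<^bold>\<and> V \<^bold>\<subseteq> U')) s"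
    unfolding generated_topology_def by simp
  have "(x \<^bold>\<in>\<^sub>0 U') q"
    using assms(2) q by (meson mem_cong_right equality_check_eq regular_mem regular_mono)
  then have "(\<^bold>\<exists>V. V \<^bold>\<in>\<^sub>1 check_family {W. openin X W} \<^bold>\<and> x \<^bold>\<in>\<^sub>0 V \<^bold>\<and> V \<^bold>\<subseteq> U') q"
    by (rule forces_impD[OF spec[OF U'[unfolded forces_all]] _ q(2)]) (intro regular_intros)+
  then obtain r V where r: "r \<le> q"
    and V: "(V \<^bold>\<in>\<^sub>1 check_family {W. openin X W}) r" "(x \<^bold>\<in>\<^sub>0 V) r" "(V \<^bold>\<subseteq> U') r"
    using forces_exD[OF _ order_refl] unfolding forces_and by blast
  obtain t W where t: "t \<le> r" and W: "openin X W" "(V \<^bold>=\<^sub>1 check W) t"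
    using forces_memD[OF V(1) order_refl] unfolding check_family_def by blast
  have "x \<in> W"
    using V(2) W(2) t
    by (meson mem_cong_right equality_check_eq regular_mem regular_mono forces_mem_check)
  moreover have "(check W \<^bold>\<subseteq> U) t"
    using V(3) W(2) q r t
    by (meson order_trans regular_mono regular_set_eq regular_subset
        subset_cong_left subset_cong_right set_eq_sym)
  ultimately show ?thesis
    using W(1) t r q(1) by (meson order_trans)
qed

text \<open>To be a cover it suffices to reach each point densely. Nothing is to be shown about points outside
the space, because open sets of the extension are unions of ground model open sets.\<close>
lemma open_cover_forcedI:
  assumes regular: "\<And>U. regular (C U)"
    and opn: "\<And>q U. q \<le> p \<Longrightarrow> C U q \<Longrightarrow> (U \<^bold>\<in>\<^sub>1 generated_topology X) q"
    and covers: "\<And>q x. q \<le> p \<Longrightarrow> x \<in> topspace X \<Longrightarrow> \<exists>r\<le>q. \<exists>U. C U r \<and> (x \<^bold>\<in>\<^sub>0 U) r"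
  shows "f_open_cover (check (topspace X)) (generated_topology X) C p"
  unfolding f_open_cover_def f_iff_def
proof (intro forces_andI forces_allI forces_impI)
  show "(U \<^bold>\<in>\<^sub>1 generated_topology X) q" if "q \<le> p" "C U q" for q U
    using that by (rule opn)
next
  fix x q assume q: "q \<le> p" and "(\<^bold>\<exists>U. C U \<^bold>\<and> x \<^bold>\<in>\<^sub>0 U) q"
  then obtain r U where "r \<le> q" "C U r" "(x \<^bold>\<in>\<^sub>0 U) r"
    using forces_exD[OF _ order_refl] unfolding forces_and by blast
  moreover have "r \<le> p"
    using \<open>r \<le> q\<close> q by (rule order_trans)
  ultimately obtain W where "openin X W" "x \<in> W"
    using mem_generated_topologyD[OF opn] by blast
  then have "x \<in> topspace X"
    using openin_subset by blast
  then show "(x \<^bold>\<in>\<^sub>0 check (topspace X)) q"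
    by (simp add: forces_mem_check)
next
  fix x q assume q: "q \<le> p" and x: "(x \<^bold>\<in>\<^sub>0 check (topspace X)) q"
  have regular_ex: "regular (\<^bold>\<exists>U. C U \<^bold>\<and> x \<^bold>\<in>\<^sub>0 U)"
    by (intro regular_intros regular)
  show "(\<^bold>\<exists>U. C U \<^bold>\<and> x \<^bold>\<in>\<^sub>0 U) q"
  proof (rule regular_dense[OF regular_ex])
    fix q' assume "q' \<le> q"
    then obtain r U where "r \<le> q'" "C U r" "(x \<^bold>\<in>\<^sub>0 U) r"
      using covers[of q' x] x order_trans[OF _ q] unfolding forces_mem_check by blast
    then have "(C U \<^bold>\<and> x \<^bold>\<in>\<^sub>0 U) r"
      by (simp add: forces_and)
    then have "(\<^bold>\<exists>U. C U \<^bold>\<and> x \<^bold>\<in>\<^sub>0 U) r"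
      by (rule forces_exI) (intro regular_intros regular)
    then show "\<exists>r\<le>q'. (\<^bold>\<exists>U. C U \<^bold>\<and> x \<^bold>\<in>\<^sub>0 U) r"
      using \<open>r \<le> q'\<close> by blast
  qed
qed

section \<open>Antichains\<close>

text \<open>By Zorn's lemma: an antichain that is maximal among the antichains contained in \<open>D\<close> cannot be
enlarged by any element of \<open>D\<close>.\<close>
lemma exists_predense_antichain:
  fixes D :: "'p::preorder set"
  shows "\<exists>A\<subseteq>D. antichain A \<and> (\<forall>d\<in>D. \<exists>a\<in>A. compatible d a)"
proof -
  let ?C = "{A. A \<subseteq> D \<and> antichain A}"
  have "\<exists>M\<in>?C. \<forall>A\<in>?C. M \<subseteq> A \<longrightarrow> A = M"
  proof (rule subset_Zorn')
    fix \<C> assume chain: "subset.chain ?C \<C>"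
    have "antichain (\<Union>\<C>)"
      unfolding antichain_def pairwise_def
    proof (intro ballI impI)
      fix a b assume ab: "a \<in> \<Union>\<C>" "b \<in> \<Union>\<C>" "a \<noteq> b"
      then obtain A B where AB: "A \<in> \<C>" "B \<in> \<C>" "a \<in> A" "b \<in> B"
        by blast
      then have "A \<subseteq> B \<or> B \<subseteq> A" "antichain A" "antichain B"
        using chain unfolding subset.chain_def by blast+
      then show "\<not> compatible a b"
        using AB ab unfolding antichain_def pairwise_def by blast
    qed
    then show "\<Union>\<C> \<in> ?C"
      using chain unfolding subset.chain_def by blast
  qed
  then obtain A where "A \<in> ?C" and maximal: "\<forall>B\<in>?C. A \<subseteq> B \<longrightarrow> B = A"
    by (elim bexE)
  then have A: "A \<subseteq> D" "antichain A"
    by simp_all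
  have max: "B = A" if "B \<subseteq> D" "antichain B" "A \<subseteq> B" for B
    using maximal that by simp
  have "\<exists>a\<in>A. compatible d a" if d: "d \<in> D" for d
  proof (rule ccontr)
    assume *: "\<not> (\<exists>a\<in>A. compatible d a)"
    then have "antichain (insert d A)"
      using A(2) unfolding antichain_def pairwise_insert compatible_def by blast
    then have "d \<in> A"
      using max[of "insert d A"] A(1) d by blast
    then show False
      using * unfolding compatible_def by (meson order_refl)
  qed
  then show ?thesis
    using A by blast
qed

lemma dense_contains_maximal_antichain:
  fixes D :: "'p::preorder set"
  assumes dense: "\<And>p. \<exists>d\<in>D. d \<le> p"
  shows "\<exists>A\<subseteq>D. maximal_antichain A"
proof -
  obtain A where A: "A \<subseteq> D" "antichain A" "\<And>d. d \<in> D \<Longrightarrow> \<exists>a\<in>A. compatible d a"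
    using exists_predense_antichain[of D] by blast
  have "b \<in> A" if B: "antichain B" "A \<subseteq> B" "b \<in> B" for B b
  proof -
    obtain d where d: "d \<in> D" "d \<le> b"
      using dense by blast
    then obtain a where "a \<in> A" "compatible d a"
      using A(3) by blast
    then have "compatible b a"
      using d(2) order_trans unfolding compatible_def by blast
    then show "b \<in> A"
      using \<open>a \<in> A\<close> B unfolding antichain_def by (metis pairwiseD subsetD)
  qed
  then show ?thesis
    using A(1,2) unfolding maximal_antichain_def by blast
qed

text \<open>The maximum principle for sequences. For each \<open>n\<close>, choose an antichain that is predense below \<open>p\<close> and
whose elements \<open>a\<close> have a witness \<open>Y n a\<close>; the name consisting of the pairs \<open>(n, Y n a)\<close> with condition
\<open>a\<close> is the desired sequence. Placing the mixture in the sequence avoids mixing the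
values, so the argument is the same for values of any rank.\<close>
lemma sequence_choice:
  fixes E :: "'n \<Rightarrow> 'n \<Rightarrow> 'p::preorder formula"
  assumes E: "equality E"
    and mono: "\<And>n y q r. \<phi> n y q \<Longrightarrow> r \<le> q \<Longrightarrow> \<phi> n y r"
    and dense: "\<And>n q. q \<le> p \<Longrightarrow> \<exists>r\<le>q. \<exists>y. \<phi> n y r"
  shows "\<exists>S. f_sequence E S p \<and>
    (\<forall>q n y. f_value E S n y q \<longrightarrow> (\<exists>r\<le>q. \<exists>z. \<phi> n z r \<and> E y z r))"
proof -
  define D where "D n = {r. \<exists>y. \<phi> n y r}" for n
  have "\<forall>n. \<exists>A\<subseteq>D n. antichain A \<and> (\<forall>d\<in>D n. \<exists>a\<in>A. compatible d a)"
    using exists_predense_antichain by blast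
  then obtain A where A: "\<And>n. A n \<subseteq> D n" "\<And>n. antichain (A n)"
    "\<And>n d. d \<in> D n \<Longrightarrow> \<exists>a\<in>A n. compatible d a"
    by metis
  have "\<forall>n. \<forall>a\<in>A n. \<exists>y. \<phi> n y a"
    using A(1) unfolding D_def by blast
  then obtain Y where Y: "\<And>n a. a \<in> A n \<Longrightarrow> \<phi> n (Y n a) a"
    by metis
  define S where "S = {((n, Y n a), a) | n a. a \<in> A n}"
  have valueI: "f_value E S n (Y n a) r" if "a \<in> A n" "r \<le> a" for n a r
    unfolding f_value_def
    by (rule forces_memI[of "(n, Y n a)" a])
      (use that E in \<open>auto simp: S_def equality_refl[OF equality_pair_eq[OF equality_check_eq E]]
        intro: regular_intros equality_regular\<close>)
  have valueD: "\<exists>r\<le>q. \<exists>a\<in>A n. r \<le> a \<and> E y (Y n a) r" if val: "f_value E S n y q" for q n y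
  proof -
    obtain r x s where r: "r \<le> q" "r \<le> s" and x: "(x, s) \<in> S" "f_pair_eq f_eq0 E (n, y) x r"
      using forces_memD[OF val[unfolded f_value_def] order_refl] by blast
    obtain m a where "x = (m, Y m a)" "s = a" "a \<in> A m"
      using x(1) unfolding S_def by blast
    moreover from this have "m = n" "E y (Y m a) r"
      using x(2) by (auto simp: f_pair_eq_def f_and_def f_check_eq_def)
    ultimately show ?thesis
      using r by blast
  qed
  have "f_sequence E S p"
    unfolding f_sequence_def
  proof (intro forces_andI forces_allI forces_impI)
    fix n
    have regular_ex: "regular (\<^bold>\<exists>y. f_value E S n y)"
      by (intro regular_intros)
    show "(\<^bold>\<exists>y. f_value E S n y) p"
    proof (rule regular_dense[OF regular_ex])
      fix q assume "q \<le> p"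
      then obtain r where r: "r \<le> q" "r \<in> D n"
        using dense unfolding D_def by blast
      then obtain a t where a: "a \<in> A n" "t \<le> r" "t \<le> a"
        using A(3) unfolding compatible_def by blast
      have "f_value E S n (Y n a) t"
        using a(1,3) by (rule valueI)
      then have "(\<^bold>\<exists>y. f_value E S n y) t"
        by (rule forces_exI) (rule regular_value)
      then show "\<exists>t\<le>q. (\<^bold>\<exists>y. f_value E S n y) t"
        using a r order_trans by blast
    qed
  next
    fix n y z q assume "(f_value E S n y \<^bold>\<and> f_value E S n z) q"
    then have yz: "f_value E S n y q" "f_value E S n z q"
      unfolding forces_and by blast+
    show "E y z q"
    proof (rule regular_dense[OF equality_regular[OF E]])
      fix q' assume q': "q' \<le> q"
      then obtain r a where r: "r \<le> q'" and a: "a \<in> A n" "r \<le> a" "E y (Y n a) r"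
        using valueD[OF regular_mono[OF regular_value yz(1)]] by blast
      then have "r \<le> q"
        using q' order_trans by blast
      then obtain t b where t: "t \<le> r" and b: "b \<in> A n" "t \<le> b" "E z (Y n b) t"
        using valueD[OF regular_mono[OF regular_value yz(2)]] by blast
      have "t \<le> a"
        using t a order_trans by blast
      then have "compatible a b"
        using b unfolding compatible_def by blast
      then have "a = b"
        using a(1) b(1) A(2)[of n] unfolding antichain_def by (metis pairwiseD)
      moreover have "E y (Y n a) t"
        using a t regular_mono[OF equality_regular[OF E]] by blast
      ultimately have "E y z t"
        using b E equality_sym equality_trans by metis
      then show "\<exists>t\<le>q'. E y z t"
        using t r order_trans by blast
    qed
  qed
  moreover have "\<exists>r\<le>q. \<exists>z. \<phi> n z r \<and> E y z r" if val: "f_value E S n y q" for q n y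
    using valueD[OF val] Y mono by blast
  ultimately show ?thesis
    by blast
qed

section \<open>Ground model covers from weak endowment\<close>

text \<open>This is where the weak endowment is used. The predicate \<open>\<psi> n W\<close> stands for the set of conditions
forcing that \<open>W\<close> is good at stage \<open>n\<close>. A maximal antichain contains a finite \<open>L\<close>
from the endowment, so the neighbourhoods attached to the elements of \<open>L\<close> can be intersected; the compatibility clause, which applies to all
stages from some stage on, gives the last conjunct.\<close>
lemma endowed_covers:
  fixes X :: "'a topology" and \<psi> :: "nat \<Rightarrow> 'a set \<Rightarrow> 'p::preorder formula"
  assumes endowed: "weakly_endowed TYPE('p)"
    and mono: "\<And>n W q r. \<psi> n W q \<Longrightarrow> r \<le> q \<Longrightarrow> \<psi> n W r"
    and antimono: "\<And>n W W' q. \<psi> n W q \<Longrightarrow> W' \<subseteq> W \<Longrightarrow> \<psi> n W' q"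
    and dense: "\<And>n x q. q \<le> p \<Longrightarrow> x \<in> topspace X \<Longrightarrow>
      \<exists>r\<le>q. \<exists>W. openin X W \<and> x \<in> W \<and> \<psi> n W r"
  shows "\<exists>\<W>. (\<forall>n. open_cover X (\<W> n)) \<and>
    (\<forall>n. \<forall>W\<in>\<W> n. \<forall>W'. openin X W' \<and> W' \<subseteq> W \<longrightarrow> W' \<in> \<W> n) \<and>
    (\<forall>r\<le>p. \<exists>m. \<forall>n\<ge>m. \<forall>W\<in>\<W> n. \<exists>t\<le>r. \<psi> n W t)"
proof -
  obtain P :: "nat \<Rightarrow> 'p set" and \<L> where P: "(\<Union>n. P n) = UNIV" "\<forall>n. P n \<subseteq> P (Suc n)"
    and \<L>: "\<forall>n. (\<forall>L\<in>\<L> n. finite L \<and> antichain L) \<and>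
      (\<forall>A. maximal_antichain A \<longrightarrow> (\<exists>L\<in>\<L> n. L \<subseteq> A)) \<and>
      (\<forall>p\<in>P n. \<forall>L\<in>\<L> n. \<exists>q\<in>L. compatible p q)"
    using endowed unfolding weakly_endowed_def by (elim exE conjE) (rule that)
  have fin: "finite L" if "L \<in> \<L> n" for n L
    using that \<L> by simp
  have sub: "\<exists>L\<in>\<L> n. L \<subseteq> A" if "maximal_antichain A" for n A
    using that \<L> by simp
  have meets: "\<exists>q\<in>L. compatible p q" if "p \<in> P n" "L \<in> \<L> n" for n p L
    using that \<L> by simp
  \<comment> \<open>A maximal antichain has to be maximal in the whole forcing notion, although only conditions
    below \<open>p\<close> matter. Conditions incompatible with \<open>p\<close> decide every set vacuously.\<close>
  define decides where "decides n W q \<longleftrightarrow> (\<forall>r. r \<le> q \<and> r \<le> p \<longrightarrow> \<psi> n W r)" for n W q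
  define \<W> where "\<W> n = {W. openin X W \<and> (\<exists>L\<in>\<L> n. \<forall>q\<in>L. decides n W q)}" for n
  have decides_antimono: "decides n W' q" if "decides n W q" "W' \<subseteq> W" for n W W' q
    using that antimono unfolding decides_def by blast
  have down: "W' \<in> \<W> n" if W: "W \<in> \<W> n" and W': "openin X W'" "W' \<subseteq> W" for n W W'
  proof -
    obtain L where L: "L \<in> \<L> n" "\<forall>q\<in>L. decides n W q"
      using W unfolding \<W>_def by auto
    then have "\<forall>q\<in>L. decides n W' q"
      using decides_antimono[OF _ W'(2)] by simp
    then show ?thesis
      using W'(1) L(1) unfolding \<W>_def by auto
  qed
  have cover: "open_cover X (\<W> n)" for n
    unfolding open_cover_def
  proof (intro conjI ballI equalityI subsetI)
    fix x assume x: "x \<in> topspace X"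
    define D where "D = {q. \<exists>W. openin X W \<and> x \<in> W \<and> decides n W q}"
    have "\<exists>d\<in>D. d \<le> q" for q
    proof (cases "compatible q p")
      case True
      then obtain r where r: "r \<le> q" "r \<le> p"
        unfolding compatible_def by blast
      obtain t W where t: "t \<le> r" "openin X W" "x \<in> W" "\<psi> n W t"
        using dense[OF r(2) x] by blast
      then have "decides n W t"
        using mono[OF t(4)] unfolding decides_def by simp
      then have "t \<in> D"
        using t unfolding D_def by auto
      moreover have "t \<le> q"
        using t r order_trans by blast
      ultimately show ?thesis
        by blast
    next
      case False
      then have "decides n (topspace X) q"
        unfolding compatible_def decides_def by blast
      then have "q \<in> D"
        using x unfolding D_def by blast
      then show ?thesis
        using order_refl by blast
    qed
    then obtain A where "A \<subseteq> D" "maximal_antichain A"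
      using dense_contains_maximal_antichain by blast
    then obtain L where L: "L \<in> \<L> n" "L \<subseteq> D"
      using sub by blast
    then have "\<forall>q\<in>L. \<exists>W. openin X W \<and> x \<in> W \<and> decides n W q"
      unfolding D_def by blast
    then obtain W where W: "\<And>q. q \<in> L \<Longrightarrow> openin X (W q) \<and> x \<in> W q \<and> decides n (W q) q"
      by metis
    \<comment> \<open>The factor \<open>topspace X\<close> keeps the intersection open when \<open>L\<close> is empty.\<close>
    define W0 where "W0 = topspace X \<inter> \<Inter>(W ` L)"
    have "openin X W0"
    proof (cases "L = {}")
      case False
      then show ?thesis
        unfolding W0_def using fin[OF L(1)] W by (intro openin_Int openin_topspace openin_Inter) auto
    qed (simp add: W0_def)
    moreover have "decides n W0 q" if "q \<in> L" for q
    proof -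
      have "W0 \<subseteq> W q"
        using that unfolding W0_def by blast
      then show ?thesis
        using W[OF that] decides_antimono by blast
    qed
    ultimately have "W0 \<in> \<W> n"
      using L(1) unfolding \<W>_def by blast
    moreover have "x \<in> W0"
      using x W unfolding W0_def by blast
    ultimately show "x \<in> \<Union>(\<W> n)"
      by blast
  qed (use openin_subset in \<open>auto simp: \<W>_def\<close>)
  have "\<exists>m. \<forall>n\<ge>m. \<forall>W\<in>\<W> n. \<exists>t\<le>r. \<psi> n W t" if r: "r \<le> p" for r
  proof -
    obtain m where m: "r \<in> P m"
      using P(1) by blast
    have "\<exists>t\<le>r. \<psi> n W t" if "m \<le> n" "W \<in> \<W> n" for n W
    proof -
      have "r \<in> P n"
        using m lift_Suc_mono_le[of P, OF P(2)[rule_format] \<open>m \<le> n\<close>] by blast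
      moreover obtain L where L: "L \<in> \<L> n" "\<forall>q\<in>L. decides n W q"
        using \<open>W \<in> \<W> n\<close> unfolding \<W>_def by blast
      ultimately obtain q t where "q \<in> L" "t \<le> r" "t \<le> q"
        using meets unfolding compatible_def by blast
      moreover have "t \<le> p"
        using \<open>t \<le> r\<close> r by (rule order_trans)
      ultimately show ?thesis
        using L(2) unfolding decides_def by blast
    qed
    then show ?thesis
      by blast
  qed
  then show ?thesis
    using cover down by blast
qed

text \<open>A common form of the three covering properties: \<open>Q\<close> says that a family is a singleton, finite, or
pairwise disjoint. Refinement may replace inclusion, since the covers it is applied to are
closed under passing to smaller open sets.\<close>
definition selects :: "('a set set \<Rightarrow> bool) \<Rightarrow> 'a topology \<Rightarrow> bool" where
  "selects Q X \<longleftrightarrow>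
     (\<forall>\<U> :: nat \<Rightarrow> 'a set set. (\<forall>n. open_cover X (\<U> n)) \<longrightarrow>
        (\<exists>\<S> :: nat \<Rightarrow> 'a set set. (\<forall>n. Q (\<S> n) \<and> refines (\<S> n) (\<U> n)) \<and> open_cover X (\<Union>n. \<S> n)))"

lemma rothberger_selects:
  assumes "rothberger X"
  shows "selects is_singleton X"
  unfolding selects_def
proof (intro allI impI)
  fix \<U> :: "nat \<Rightarrow> 'a set set" assume "\<forall>n. open_cover X (\<U> n)"
  then obtain U where U: "\<And>n. U n \<in> \<U> n" "open_cover X (range U)"
    using assms unfolding rothberger_def by blast
  moreover have "(\<Union>n. {U n}) = range U"
    by blast
  ultimately show "\<exists>\<S>. (\<forall>n. is_singleton (\<S> n) \<and> refines (\<S> n) (\<U> n)) \<and> open_cover X (\<Union>n. \<S> n)"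
    unfolding refines_def by (intro exI[of _ "\<lambda>n. {U n}"]) auto
qed

lemma menger_selects: "menger X \<Longrightarrow> selects finite X"
  unfolding selects_def menger_def refines_def by (meson order_refl subsetD)

lemma selectively_screenable_selects:
  "selectively_screenable X \<Longrightarrow> selects (pairwise disjnt) X"
  unfolding selects_def selectively_screenable_def by meson

text \<open>The pairing function splits the stages into columns, and column \<open>m\<close> contains only stages \<open>\<ge> m\<close>.
Selecting a cover along every column hits each point arbitrarily late.\<close>
lemma selects_infinitely_often:
  fixes \<U> :: "nat \<Rightarrow> 'a set set"
  assumes "selects Q X" and covers: "\<And>n. open_cover X (\<U> n)"
  shows "\<exists>\<S>. (\<forall>n. Q (\<S> n) \<and> (\<forall>W\<in>\<S> n. openin X W) \<and> refines (\<S> n) (\<U> n)) \<and>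
    (\<forall>x\<in>topspace X. \<forall>m. \<exists>n\<ge>m. \<exists>W\<in>\<S> n. x \<in> W)"
proof -
  have "\<forall>i. \<exists>\<S>. (\<forall>j. Q (\<S> j) \<and> refines (\<S> j) (\<U> (prod_encode (i, j)))) \<and>
      open_cover X (\<Union>j. \<S> j)"
    using assms(1)[unfolded selects_def, rule_format, OF covers] by simp
  then have "\<exists>\<S>. \<forall>i. (\<forall>j. Q (\<S> i j) \<and> refines (\<S> i j) (\<U> (prod_encode (i, j)))) \<and>
      open_cover X (\<Union>j. \<S> i j)"
    by (rule choice)
  then obtain \<S> where \<S>:
    "\<And>i j. Q (\<S> i j) \<and> refines (\<S> i j) (\<U> (prod_encode (i, j)))"
    "\<And>i. open_cover X (\<Union>j. \<S> i j)"
    by auto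
  define \<T> where "\<T> n = (case prod_decode n of (i, j) \<Rightarrow> \<S> i j)" for n
  have \<T>: "\<T> (prod_encode (i, j)) = \<S> i j" for i j
    unfolding \<T>_def by simp
  have "Q (\<T> n) \<and> (\<forall>W\<in>\<T> n. openin X W) \<and> refines (\<T> n) (\<U> n)" for n
  proof -
    obtain i j where n: "n = prod_encode (i, j)"
      by (metis prod_decode_inverse surj_pair)
    then show ?thesis
      unfolding n \<T> using \<S>(1)[of i j] \<S>(2)[of i] unfolding open_cover_def by blast
  qed
  moreover have "\<exists>n\<ge>m. \<exists>W\<in>\<T> n. x \<in> W" if "x \<in> topspace X" for x m
  proof -
    have "\<Union>(\<Union>j. \<S> m j) = topspace X"
      using \<S>(2)[of m] unfolding open_cover_def by (rule conjunct2)
    then have "x \<in> \<Union>(\<Union>j. \<S> m j)"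
      using that by (rule ssubst)
    then obtain j W where "W \<in> \<S> m j" "x \<in> W"
      by auto
    then have "m \<le> prod_encode (m, j)" "\<exists>W\<in>\<T> (prod_encode (m, j)). x \<in> W"
      using le_prod_encode_1 \<T> by auto
    then show ?thesis
      by blast
  qed
  ultimately show ?thesis
    by (intro exI[of _ \<T>] conjI allI ballI) simp_all
qed

section \<open>Selections in the extension\<close>

lemma
  assumes "f_sequence_of_open_covers Y T \<U> p" "q \<le> p"
  shows cover_exists: "\<exists>r\<le>q. \<exists>\<A>. f_value2 \<U> n \<A> r"
    and cover_unique: "f_value2 \<U> n \<A> q \<Longrightarrow> f_value2 \<U> n \<B> q \<Longrightarrow> (\<A> \<^bold>=\<^sub>2 \<B>) q"
    and cover_open: "f_value2 \<U> n \<A> q \<Longrightarrow> (U \<^bold>\<in>\<^sub>1 \<A>) q \<Longrightarrow> (U \<^bold>\<in>\<^sub>1 T) q"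
    and cover_covers: "f_value2 \<U> n \<A> q \<Longrightarrow> (x \<^bold>\<in>\<^sub>0 Y) q \<Longrightarrow> \<exists>r\<le>q. \<exists>U. (U \<^bold>\<in>\<^sub>1 \<A>) r \<and> (x \<^bold>\<in>\<^sub>0 U) r"
proof -
  have seq: "(\<^bold>\<forall>n. \<^bold>\<exists>\<A>. f_value2 \<U> n \<A>) p"
    "(\<^bold>\<forall>n. \<^bold>\<forall>\<A>. \<^bold>\<forall>\<B>. f_value2 \<U> n \<A> \<^bold>\<and> f_value2 \<U> n \<B> \<^bold>\<longrightarrow> \<A> \<^bold>=\<^sub>2 \<B>) p"
    and cov: "(\<^bold>\<forall>n. \<^bold>\<forall>\<A>. f_value2 \<U> n \<A> \<^bold>\<longrightarrow> f_open_cover Y T (\<lambda>U. U \<^bold>\<in>\<^sub>1 \<A>)) p"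
    using assms(1) unfolding f_sequence_of_open_covers_def f_sequence_def f_and_def by simp_all
  show "\<exists>r\<le>q. \<exists>\<A>. f_value2 \<U> n \<A> r"
    using forces_allD[OF seq(1)] assms(2) by (rule forces_exD)
  show "(\<A> \<^bold>=\<^sub>2 \<B>) q" if "f_value2 \<U> n \<A> q" "f_value2 \<U> n \<B> q"
  proof -
    have "(f_value2 \<U> n \<A> \<^bold>\<and> f_value2 \<U> n \<B>) q"
      using that by (rule forces_andI)
    then show ?thesis
      by (rule forces_impD[OF forces_allD[OF forces_allD[OF forces_allD[OF seq(2)]]] _ assms(2)])
        (intro regular_intros)+
  qed
  have "f_open_cover Y T (\<lambda>U. U \<^bold>\<in>\<^sub>1 \<A>) q" if "f_value2 \<U> n \<A> q"
    by (rule forces_impD[OF forces_allD[OF forces_allD[OF cov]] that assms(2)])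
      (intro regular_concept_intros)+
  then have opn: "(\<^bold>\<forall>U. U \<^bold>\<in>\<^sub>1 \<A> \<^bold>\<longrightarrow> U \<^bold>\<in>\<^sub>1 T) q"
    and iff: "(\<^bold>\<forall>x. (\<^bold>\<exists>U. U \<^bold>\<in>\<^sub>1 \<A> \<^bold>\<and> x \<^bold>\<in>\<^sub>0 U) \<^bold>\<longleftrightarrow> x \<^bold>\<in>\<^sub>0 Y) q" if "f_value2 \<U> n \<A> q"
    using that unfolding f_open_cover_def f_and_def by simp_all
  show "(U \<^bold>\<in>\<^sub>1 T) q" if "f_value2 \<U> n \<A> q" "(U \<^bold>\<in>\<^sub>1 \<A>) q"
    by (rule forces_impD[OF forces_allD[OF opn] that(2) order_refl])
      (rule that regular_mem)+
  show "\<exists>r\<le>q. \<exists>U. (U \<^bold>\<in>\<^sub>1 \<A>) r \<and> (x \<^bold>\<in>\<^sub>0 U) r" if val: "f_value2 \<U> n \<A> q" and x: "(x \<^bold>\<in>\<^sub>0 Y) q"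
  proof -
    have "(x \<^bold>\<in>\<^sub>0 Y \<^bold>\<longrightarrow> (\<^bold>\<exists>U. U \<^bold>\<in>\<^sub>1 \<A> \<^bold>\<and> x \<^bold>\<in>\<^sub>0 U)) q"
      using forces_allD[OF iff[OF val], of x] unfolding f_iff_def forces_and by blast
    from this x order_refl have "(\<^bold>\<exists>U. U \<^bold>\<in>\<^sub>1 \<A> \<^bold>\<and> x \<^bold>\<in>\<^sub>0 U) q"
      by (rule forces_impD) (intro regular_intros)+
    then show ?thesis
      using forces_exD[OF _ order_refl] unfolding forces_and by blast
  qed
qed

text \<open>Here \<open>q\<close> fixes names for the cover and for its member. This is stronger than forcing the
corresponding existential statement, but holds densely below any condition that forces it.\<close>
definition captured ::
  "(('a, 'p::preorder) family_name, 'p) seq_name \<Rightarrow> nat \<Rightarrow> 'a set \<Rightarrow> 'p \<Rightarrow> bool" where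
  "captured \<U> n W q \<longleftrightarrow>
     (\<exists>\<A> V. f_value2 \<U> n \<A> q \<and> (V \<^bold>\<in>\<^sub>1 \<A>) q \<and> (check W \<^bold>\<subseteq> V) q)"

lemma captured_mono: "captured \<U> n W q \<Longrightarrow> r \<le> q \<Longrightarrow> captured \<U> n W r"
  unfolding captured_def
  using regular_mono[OF regular_value] regular_mono[OF regular_mem] regular_mono[OF regular_subset]
  by metis

lemma captured_antimono: "captured \<U> n W q \<Longrightarrow> W' \<subseteq> W \<Longrightarrow> captured \<U> n W' q"
  unfolding captured_def using subset_trans_forced[OF check_subset_check] by metis

lemma captured_selection:
  fixes X :: "'a topology" and \<U> :: "(('a, 'p::preorder) family_name, 'p) seq_name"
  assumes endowed: "weakly_endowed TYPE('p)" and selects: "selects Q X"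
    and \<U>: "f_sequence_of_open_covers (check (topspace X)) (generated_topology X) \<U> p"
  shows "\<exists>\<S>. (\<forall>n. Q (\<S> n)) \<and> (\<forall>n. \<forall>W\<in>\<S> n. openin X W) \<and>
    (\<forall>q\<le>p. \<forall>x\<in>topspace X. \<exists>n. \<exists>W\<in>\<S> n. x \<in> W \<and> (\<exists>r\<le>q. captured \<U> n W r))"
proof -
  have dense: "\<exists>r\<le>q. \<exists>W. openin X W \<and> x \<in> W \<and> captured \<U> n W r"
    if q: "q \<le> p" and x: "x \<in> topspace X" for n x q
  proof -
    obtain r \<A> where r: "r \<le> q" "f_value2 \<U> n \<A> r"
      using cover_exists[OF \<U> q] by blast
    have "r \<le> p"
      using r(1) q by (rule order_trans)
    obtain t V where t: "t \<le> r" "(V \<^bold>\<in>\<^sub>1 \<A>) t" "(x \<^bold>\<in>\<^sub>0 V) t"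
      using cover_covers[OF \<U> \<open>r \<le> p\<close> r(2)] x unfolding forces_mem_check by blast
    have "t \<le> p"
      using t(1) \<open>r \<le> p\<close> by (rule order_trans)
    have val: "f_value2 \<U> n \<A> t"
      using regular_mono[OF regular_value r(2) t(1)] .
    obtain s W where s: "s \<le> t" "openin X W" "x \<in> W" "(check W \<^bold>\<subseteq> V) s"
      using mem_generated_topologyD[OF cover_open[OF \<U> \<open>t \<le> p\<close> val t(2)] t(3)] by blast
    have "captured \<U> n W s"
      unfolding captured_def
      using regular_mono[OF regular_value val s(1)] regular_mono[OF regular_mem t(2) s(1)] s(4) by blast
    moreover have "s \<le> q"
      using s(1) t(1) r(1) order_trans by blast
    ultimately show ?thesis
      using s(2,3) by blast
  qed
  have "\<exists>\<W>. (\<forall>n. open_cover X (\<W> n)) \<and>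
      (\<forall>n. \<forall>W\<in>\<W> n. \<forall>W'. openin X W' \<and> W' \<subseteq> W \<longrightarrow> W' \<in> \<W> n) \<and>
      (\<forall>r\<le>p. \<exists>m. \<forall>n\<ge>m. \<forall>W\<in>\<W> n. \<exists>t\<le>r. captured \<U> n W t)"
    by (rule endowed_covers[OF endowed])
      (fact captured_mono captured_antimono dense)+
  then obtain \<W> where cover: "\<forall>n. open_cover X (\<W> n)"
    and down: "\<forall>n. \<forall>W\<in>\<W> n. \<forall>W'. openin X W' \<and> W' \<subseteq> W \<longrightarrow> W' \<in> \<W> n"
    and caught: "\<forall>r\<le>p. \<exists>m. \<forall>n\<ge>m. \<forall>W\<in>\<W> n. \<exists>t\<le>r. captured \<U> n W t"
    by (elim exE conjE)
  obtain \<S> where \<S>: "\<forall>n. Q (\<S> n) \<and> (\<forall>W\<in>\<S> n. openin X W) \<and> refines (\<S> n) (\<W> n)"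
    and often: "\<forall>x\<in>topspace X. \<forall>m. \<exists>n\<ge>m. \<exists>W\<in>\<S> n. x \<in> W"
    using selects_infinitely_often[where \<U> = \<W>, OF selects spec[OF cover]] by (elim exE conjE)
  have "\<exists>n. \<exists>W\<in>\<S> n. x \<in> W \<and> (\<exists>r\<le>q. captured \<U> n W r)" if q: "q \<le> p" and x: "x \<in> topspace X" for q x
  proof -
    obtain m where m: "\<forall>n\<ge>m. \<forall>W\<in>\<W> n. \<exists>t\<le>q. captured \<U> n W t"
      using caught q by auto
    obtain n W where n: "m \<le> n" "W \<in> \<S> n" "x \<in> W"
      using often x by blast
    moreover obtain V where "V \<in> \<W> n" "W \<subseteq> V"
      using \<S> n(2) unfolding refines_def by blast
    then have "W \<in> \<W> n"
      using down \<S> n(2) by blast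
    ultimately show ?thesis
      using m by blast
  qed
  then show ?thesis
    using \<S> by (intro exI[of _ \<S>]) simp
qed

text \<open>The passage from a ground model selection \<open>\<S>\<close> to a selection in the extension, for all three
properties. The formula \<open>\<phi> n y\<close> describes the \<open>n\<close>th term \<open>y\<close> to be chosen, and \<open>M U y\<close> says that the set \<open>U\<close>
belongs to that term: it is equality if the terms are single open sets, and membership if they are
families. Accordingly \<open>C S U\<close> says that \<open>U\<close> belongs to the range or to the union of the sequence
\<open>S\<close>, and \<open>G\<close> is the property that links a term with the corresponding cover.\<close>
lemma selection_forced:
  fixes X :: "'a topology" and E :: "'n \<Rightarrow> 'n \<Rightarrow> 'p::preorder formula"
    and M :: "('a, 'p) set_name \<Rightarrow> 'n \<Rightarrow> 'p formula"
    and C :: "('n, 'p) seq_name \<Rightarrow> ('a, 'p) set_name \<Rightarrow> 'p formula"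
  assumes E: "equality E"
    and M_regular: "\<And>U y. regular (M U y)"
    and M_cong: "\<And>U y z q. M U y q \<Longrightarrow> E y z q \<Longrightarrow> M U z q"
    and C_regular: "\<And>S U. regular (C S U)"
    and C_I: "\<And>S n y U q. f_value E S n y q \<Longrightarrow> M U y q \<Longrightarrow> C S U q"
    and C_D: "\<And>S U q. C S U q \<Longrightarrow> \<exists>r\<le>q. \<exists>n y. f_value E S n y r \<and> M U y r"
    and G_regular: "\<And>y \<A>. regular (G y \<A>)"
    and \<phi>_mono: "\<And>n y q r. \<phi> n y q \<Longrightarrow> r \<le> q \<Longrightarrow> \<phi> n y r"
    and \<phi>_dense: "\<And>n q. q \<le> p \<Longrightarrow> \<exists>r\<le>q. \<exists>y. \<phi> n y r"
    and good: "\<And>n y z \<A> q. q \<le> p \<Longrightarrow> \<phi> n z q \<Longrightarrow> E y z q \<Longrightarrow> f_value2 \<U> n \<A> q \<Longrightarrow> G y \<A> q"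
    and opn: "\<And>n z U q. q \<le> p \<Longrightarrow> \<phi> n z q \<Longrightarrow> M U z q \<Longrightarrow> (U \<^bold>\<in>\<^sub>1 generated_topology X) q"
    and captures: "\<And>n z W q. q \<le> p \<Longrightarrow> \<phi> n z q \<Longrightarrow> W \<in> \<S> n \<Longrightarrow> captured \<U> n W q \<Longrightarrow>
      \<exists>V. M V z q \<and> (check W \<^bold>\<subseteq> V) q"
    and covers: "\<forall>q\<le>p. \<forall>x\<in>topspace X. \<exists>n. \<exists>W\<in>\<S> n. x \<in> W \<and> (\<exists>r\<le>q. captured \<U> n W r)"
  shows "(\<^bold>\<exists>S. f_sequence E S \<^bold>\<and>
      (\<^bold>\<forall>n. \<^bold>\<forall>\<A>. \<^bold>\<forall>y. f_value2 \<U> n \<A> \<^bold>\<and> f_value E S n y \<^bold>\<longrightarrow> G y \<A>) \<^bold>\<and>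
      f_open_cover (check (topspace X)) (generated_topology X) (C S)) p"
proof -
  have "\<exists>S. f_sequence E S p \<and>
      (\<forall>q n y. f_value E S n y q \<longrightarrow> (\<exists>r\<le>q. \<exists>z. \<phi> n z r \<and> E y z r))"
    using E \<phi>_mono \<phi>_dense by (rule sequence_choice)
  then obtain S where seq: "f_sequence E S p"
    and val: "\<And>q n y. f_value E S n y q \<Longrightarrow> \<exists>r\<le>q. \<exists>z. \<phi> n z r \<and> E y z r"
    by blast
  have G: "(\<^bold>\<forall>n. \<^bold>\<forall>\<A>. \<^bold>\<forall>y. f_value2 \<U> n \<A> \<^bold>\<and> f_value E S n y \<^bold>\<longrightarrow> G y \<A>) p"
  proof (intro forces_allI forces_impI)
    fix n \<A> y q assume q: "q \<le> p" and "(f_value2 \<U> n \<A> \<^bold>\<and> f_value E S n y) q"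
    then have \<A>: "f_value2 \<U> n \<A> q" and y: "f_value E S n y q"
      unfolding forces_and by blast+
    show "G y \<A> q"
    proof (rule regular_dense[OF G_regular])
      fix q' assume q': "q' \<le> q"
      obtain r z where r: "r \<le> q'" "\<phi> n z r" "E y z r"
        using val[OF regular_mono[OF regular_value y q']] by blast
      have "r \<le> q"
        using r(1) q' by (rule order_trans)
      then have "G y \<A> r"
        using good[OF order_trans[OF _ q] r(2,3) regular_mono[OF regular_value \<A>]] by blast
      then show "\<exists>r\<le>q'. G y \<A> r"
        using r(1) by blast
    qed
  qed
  have cover: "f_open_cover (check (topspace X)) (generated_topology X) (C S) p"
  proof (rule open_cover_forcedI[OF C_regular])
    fix q U assume q: "q \<le> p" and U: "C S U q"
    show "(U \<^bold>\<in>\<^sub>1 generated_topology X) q"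
    proof (rule regular_dense[OF regular_mem])
      fix q' assume q': "q' \<le> q"
      obtain r n y where r: "r \<le> q'" "f_value E S n y r" "M U y r"
        using C_D[OF regular_mono[OF C_regular U q']] by blast
      obtain t z where t: "t \<le> r" "\<phi> n z t" "E y z t"
        using val[OF r(2)] by blast
      have "t \<le> p"
        using t(1) r(1) q' q order_trans by blast
      then have "(U \<^bold>\<in>\<^sub>1 generated_topology X) t"
        using opn t(2) M_cong[OF regular_mono[OF M_regular r(3) t(1)] t(3)] by blast
      then show "\<exists>t\<le>q'. (U \<^bold>\<in>\<^sub>1 generated_topology X) t"
        using order_trans[OF t(1) r(1)] by blast
    qed
  next
    fix q x assume q: "q \<le> p" and x: "x \<in> topspace X"
    obtain n W r where W: "W \<in> \<S> n" "x \<in> W" and r: "r \<le> q" "captured \<U> n W r"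
      using covers q x by blast
    have "(\<^bold>\<exists>y. f_value E S n y) p"
      using seq unfolding f_sequence_def f_and_def f_all_def by simp
    then have "\<exists>t\<le>r. \<exists>y. f_value E S n y t"
      by (rule forces_exD) (rule order_trans[OF r(1) q])
    then obtain t y where t: "t \<le> r" "f_value E S n y t"
      by blast
    obtain s z where s: "s \<le> t" "\<phi> n z s" "E y z s"
      using val[OF t(2)] by blast
    have "s \<le> r"
      using s(1) t(1) by (rule order_trans)
    then have "s \<le> q"
      using r(1) by (rule order_trans)
    obtain V where V: "M V z s" "(check W \<^bold>\<subseteq> V) s"
      using captures[OF order_trans[OF \<open>s \<le> q\<close> q] s(2) W(1) captured_mono[OF r(2) \<open>s \<le> r\<close>]] by blast
    have "C S V s"
      using C_I[OF regular_mono[OF regular_value t(2) s(1)]] M_cong[OF V(1) equality_sym[OF E s(3)]] by blast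
    moreover have "(x \<^bold>\<in>\<^sub>0 V) s"
      using subsetD_forced[OF V(2) _ order_refl] W(2) unfolding forces_mem_check by blast
    ultimately show "\<exists>r\<le>q. \<exists>U. C S U r \<and> (x \<^bold>\<in>\<^sub>0 U) r"
      using \<open>s \<le> q\<close> by blast
  qed
  show ?thesis
    by (rule forces_exI[of _ S], intro forces_andI seq G cover)
      (intro regular_concept_intros equality_regular[OF E] G_regular C_regular)
qed

section \<open>The Rothberger property\<close>

text \<open>The empty family covers the empty space, and nothing can be selected from it.\<close>
lemma rothberger_nonempty:
  assumes "rothberger X"
  shows "topspace X \<noteq> {}"
proof
  assume "topspace X = {}"
  then have "open_cover X {}"
    unfolding open_cover_def by simp
  then show False
    using assms[unfolded rothberger_def, rule_format, of "\<lambda>_. {}"] by simp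
qed

text \<open>The single set selected at stage \<open>n\<close> determines the choice from the \<open>n\<close>th cover if it is captured. If it
is not, an arbitrary member is chosen; there is one, because the space has a point.\<close>
lemma rothberger_forced:
  fixes X :: "'a topology"
  assumes endowed: "weakly_endowed TYPE('p::preorder)" and "rothberger X"
  shows "\<tturnstile> f_rothberger (check (topspace X) :: ('a, 'p) set_name) (generated_topology X)"
  unfolding forced_def f_rothberger_def
proof (intro allI forces_allI forces_impI)
  fix p\<^sub>0 p :: 'p and \<U> :: "(('a, 'p) family_name, 'p) seq_name"
  assume \<U>: "f_sequence_of_open_covers (check (topspace X)) (generated_topology X) \<U> p"
  obtain x where x: "x \<in> topspace X"
    using rothberger_nonempty[OF assms(2)] by blast
  obtain \<S> where single: "\<forall>n. is_singleton (\<S> n)"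
    and covers: "\<forall>q\<le>p. \<forall>x\<in>topspace X. \<exists>n. \<exists>W\<in>\<S> n. x \<in> W \<and> (\<exists>r\<le>q. captured \<U> n W r)"
    using captured_selection[OF endowed rothberger_selects[OF assms(2)] \<U>] by (elim exE conjE)
  define \<phi> where "\<phi> n V q \<longleftrightarrow> (\<exists>\<A>. f_value2 \<U> n \<A> q \<and> (V \<^bold>\<in>\<^sub>1 \<A>) q) \<and>
    (\<forall>W\<in>\<S> n. \<forall>r\<le>q. captured \<U> n W r \<longrightarrow> (check W \<^bold>\<subseteq> V) r)" for n V q
  show "(\<^bold>\<exists>S. f_sequence f_eq1 S \<^bold>\<and>
      (\<^bold>\<forall>n. \<^bold>\<forall>\<A>. \<^bold>\<forall>U. f_value2 \<U> n \<A> \<^bold>\<and> f_value1 S n U \<^bold>\<longrightarrow> U \<^bold>\<in>\<^sub>1 \<A>) \<^bold>\<and>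
      f_open_cover (check (topspace X)) (generated_topology X) (\<lambda>U. \<^bold>\<exists>n. f_value1 S n U)) p"
  proof (rule selection_forced[where M = f_eq1 and \<phi> = \<phi> and \<S> = \<S>
        and C = "\<lambda>S U. \<^bold>\<exists>n. f_value1 S n U", OF equality1])
    show "(\<^bold>\<exists>n. f_value1 S n U) q" if "f_value1 S n y q" "(U \<^bold>=\<^sub>1 y) q" for S n y U q
    proof -
      have "f_value1 S n U q"
        using value_cong[OF equality1 set_eq_sym[OF that(2)] that(1)] .
      then show ?thesis
        by (rule forces_exI) (rule regular_value)
    qed
    show "\<exists>r\<le>q. \<exists>n y. f_value1 S n y r \<and> (U \<^bold>=\<^sub>1 y) r" if "(\<^bold>\<exists>n. f_value1 S n U) q" for S U q
      using forces_exD[OF that order_refl] equality_refl[OF equality1] by blast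
    show "\<phi> n V r" if "\<phi> n V q" "r \<le> q" for n V q r
    proof -
      have "\<exists>\<A>. f_value2 \<U> n \<A> r \<and> (V \<^bold>\<in>\<^sub>1 \<A>) r"
        using that regular_mono[OF regular_value _ that(2)] regular_mono[OF regular_mem _ that(2)]
        unfolding \<phi>_def by meson
      moreover have "\<forall>W\<in>\<S> n. \<forall>t\<le>r. captured \<U> n W t \<longrightarrow> (check W \<^bold>\<subseteq> V) t"
        using that(1) order_trans[OF _ that(2)] unfolding \<phi>_def by simp
      ultimately show ?thesis
        unfolding \<phi>_def by (rule conjI)
    qed
    show "\<exists>r\<le>q. \<exists>V. \<phi> n V r" if q: "q \<le> p" for n q
    proof -
      obtain W where W: "\<S> n = {W}"
        using single by (metis is_singletonE)
      show ?thesis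
      proof (cases "\<exists>r\<le>q. captured \<U> n W r")
        case True
        then obtain r \<A> V where r: "r \<le> q"
          and V: "f_value2 \<U> n \<A> r" "(V \<^bold>\<in>\<^sub>1 \<A>) r" "(check W \<^bold>\<subseteq> V) r"
          unfolding captured_def by blast
        have "\<phi> n V r"
          using V regular_mono[OF regular_subset V(3)] unfolding \<phi>_def W by auto
        then show ?thesis
          using r by blast
      next
        case False
        obtain r \<A> where r: "r \<le> q" "f_value2 \<U> n \<A> r"
          using cover_exists[OF \<U> q] by blast
        then obtain t V where t: "t \<le> r" "(V \<^bold>\<in>\<^sub>1 \<A>) t"
          using cover_covers[OF \<U> order_trans[OF r(1) q] r(2)] x unfolding forces_mem_check by blast
        have tq: "t \<le> q"
          using t(1) r(1) by (rule order_trans)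
        have "\<not> captured \<U> n W s" if "s \<le> t" for s
          using False order_trans[OF that tq] by blast
        then have "\<phi> n V t"
          using regular_mono[OF regular_value r(2) t(1)] t(2) unfolding \<phi>_def W by auto
        then show ?thesis
          using tq by blast
      qed
    qed
    show "(y \<^bold>\<in>\<^sub>1 \<A>) q"
      if q: "q \<le> p" and z: "\<phi> n z q" and yz: "(y \<^bold>=\<^sub>1 z) q" and \<A>: "f_value2 \<U> n \<A> q" for n y z \<A> q
    proof -
      obtain \<B> where \<B>: "f_value2 \<U> n \<B> q" "(z \<^bold>\<in>\<^sub>1 \<B>) q"
        using z unfolding \<phi>_def by blast
      have "(z \<^bold>\<in>\<^sub>1 \<A>) q"
        using mem_cong_right[OF equality1 cover_unique[OF \<U> q \<B>(1) \<A>] \<B>(2)] .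
      then show ?thesis
        by (rule mem_cong_left[OF equality1 set_eq_sym[OF yz]])
    qed
    show "(U \<^bold>\<in>\<^sub>1 generated_topology X) q"
      if q: "q \<le> p" and z: "\<phi> n z q" and yz: "(U \<^bold>=\<^sub>1 z) q" for n z U q
    proof -
      obtain \<B> where \<B>: "f_value2 \<U> n \<B> q" "(z \<^bold>\<in>\<^sub>1 \<B>) q"
        using z unfolding \<phi>_def by blast
      have "(z \<^bold>\<in>\<^sub>1 generated_topology X) q"
        using cover_open[OF \<U> q \<B>] .
      then show ?thesis
        by (rule mem_cong_left[OF equality1 set_eq_sym[OF yz]])
    qed
    show "\<exists>V. (V \<^bold>=\<^sub>1 z) q \<and> (check W \<^bold>\<subseteq> V) q"
      if "\<phi> n z q" "W \<in> \<S> n" "captured \<U> n W q" for n z W q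
      using that equality_refl[OF equality1] order_refl unfolding \<phi>_def by blast
  qed (fact covers | intro regular_intros | erule equality_trans[OF equality1], assumption)+
qed

section \<open>The Menger property\<close>

text \<open>Finitely many names for elements may coincide in the extension in various ways. Deciding the
equalities one at a time leads, below any condition, to a list of representatives that are forced to
be distinct.\<close>
lemma decided_representatives:
  fixes E :: "'n \<Rightarrow> 'n \<Rightarrow> 'p::preorder formula"
  assumes E: "equality E" and "finite G"
  shows "\<exists>r\<le>q. \<exists>ys. set ys \<subseteq> G \<and>
    (\<forall>i<length ys. \<forall>j<length ys. i \<noteq> j \<longrightarrow> (\<^bold>\<not> E (ys ! i) (ys ! j)) r) \<and>
    (\<forall>V\<in>G. \<exists>i<length ys. E V (ys ! i) r)"
  using assms(2)
proof (induction G)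
  case empty
  show ?case
    by (intro exI[of _ q] conjI exI[of _ "[]"]) simp_all
next
  case (insert V G)
  then obtain r ys where r: "r \<le> q" and ys: "set ys \<subseteq> G"
    and distinct: "\<forall>i<length ys. \<forall>j<length ys. i \<noteq> j \<longrightarrow> (\<^bold>\<not> E (ys ! i) (ys ! j)) r"
    and rep: "\<forall>V\<in>G. \<exists>i<length ys. E V (ys ! i) r"
    by (elim exE conjE)
  have E_mono: "E x y t" if "E x y r" "t \<le> r" for x y t
    using regular_mono[OF equality_regular[OF E]] that by blast
  show ?case
  proof (cases "\<exists>t\<le>r. \<exists>i<length ys. E V (ys ! i) t")
    case True
    then obtain t i where t: "t \<le> r" "i < length ys" "E V (ys ! i) t"
      by blast
    have "(\<^bold>\<not> E (ys ! i) (ys ! j)) t" if "i < length ys" "j < length ys" "i \<noteq> j" for i j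
      using distinct that regular_mono[OF regular_not[OF equality_regular[OF E]] _ t(1)] by simp
    moreover have "\<exists>i<length ys. E W (ys ! i) t" if "W \<in> insert V G" for W
      using that t rep E_mono[OF _ t(1)] by blast
    ultimately show ?thesis
      using ys by (intro exI[of _ t] conjI exI[of _ ys] order_trans[OF t(1) r]) auto
  next
    case False
    have new: "(\<^bold>\<not> E V (ys ! i)) r" "(\<^bold>\<not> E (ys ! i) V) r" if "i < length ys" for i
      using False that equality_sym[OF E] unfolding f_not_def by blast+
    let ?ys = "ys @ [V]"
    have "(\<^bold>\<not> E (?ys ! i) (?ys ! j)) r" if "i < length ?ys" "j < length ?ys" "i \<noteq> j" for i j
      using that distinct new by (cases "i < length ys"; cases "j < length ys") (auto simp: nth_append)
    moreover have "\<exists>i<length ?ys. E W (?ys ! i) r" if "W \<in> insert V G" for W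
    proof (cases "W = V")
      case True
      then show ?thesis
        using equality_refl[OF E] by (intro exI[of _ "length ys"]) simp
    next
      case False
      then obtain i where "i < length ys" "E W (ys ! i) r"
        using rep \<open>W \<in> insert V G\<close> by blast
      then show ?thesis
        by (intro exI[of _ i]) (simp add: nth_append)
    qed
    ultimately show ?thesis
      using ys by (intro exI[of _ r] conjI exI[of _ ?ys] r) auto
  qed
qed

text \<open>A name whose elements are given by finitely many names is forced to be finite: below any condition the
equalities between these names can be decided, and the list of representatives then is the
required bijection with a natural number. This number depends on the condition.\<close>
lemma finite_forcedI:
  fixes \<F> :: "('a, 'p::preorder) family_name"
  assumes "finite G" and into: "\<And>V. V \<in> G \<Longrightarrow> (V \<^bold>\<in>\<^sub>1 \<F>) p"
    and onto: "\<And>U q. q \<le> p \<Longrightarrow> (U \<^bold>\<in>\<^sub>1 \<F>) q \<Longrightarrow> \<exists>r\<le>q. \<exists>V\<in>G. (U \<^bold>=\<^sub>1 V) r"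
  shows "f_finite \<F> p"
proof (rule regular_dense[OF regular_finite])
  fix p' assume p': "p' \<le> p"
  obtain r ys where r: "r \<le> p'" and ys: "set ys \<subseteq> G"
    and distinct: "\<forall>i<length ys. \<forall>j<length ys. i \<noteq> j \<longrightarrow> (\<^bold>\<not> ys ! i \<^bold>=\<^sub>1 ys ! j) r"
    and rep: "\<forall>V\<in>G. \<exists>i<length ys. (V \<^bold>=\<^sub>1 ys ! i) r"
    using decided_representatives[OF equality1 assms(1), of p'] by (elim exE conjE)
  have rp: "r \<le> p"
    using r p' by (rule order_trans)
  \<comment> \<open>The indices and the list live in the ground model, so the bijection is given by a name
    that attaches every condition to each pair.\<close>
  define f :: "(('a, 'p) set_name, 'p) seq_name" where
    "f = (\<lambda>i. (i, ys ! i)) ` {..<length ys} \<times> UNIV"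
  have value_iff: "f_value1 f n U t \<longleftrightarrow> n < length ys \<and> (U \<^bold>=\<^sub>1 ys ! n) t" for n U t
  proof
    assume val: "f_value1 f n U t"
    have *: "n < length ys \<and> (U \<^bold>=\<^sub>1 ys ! n) s"
      if "(y, s') \<in> f" "f_pair_eq f_eq0 f_eq1 (n, U) y s" for y s s'
      using that unfolding f_def f_pair_eq_def f_and_def f_check_eq_def by auto
    have "n < length ys"
      using forces_memD[OF val[unfolded f_value_def] order_refl] * by blast
    moreover have "(U \<^bold>=\<^sub>1 ys ! n) t"
      using val[unfolded f_value_def] regular_set_eq by (rule forces_memE) (use * in blast)
    ultimately show "n < length ys \<and> (U \<^bold>=\<^sub>1 ys ! n) t"
      by (rule conjI)
  next
    assume "n < length ys \<and> (U \<^bold>=\<^sub>1 ys ! n) t"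
    then show "f_value1 f n U t"
      unfolding f_value_def
      by (intro forces_memI[of "(n, ys ! n)" t] regular_pair_eq regular_check_eq regular_set_eq)
        (auto simp: f_def f_pair_eq_def f_and_def equality_refl[OF equality_check_eq])
  qed
  have "f_enumerates f (length ys) \<F> r"
    unfolding f_enumerates_def
  proof (intro forces_andI forces_allI forces_impI)
    fix n U q assume q: "q \<le> r" and "f_value1 f n U q"
    then have n: "n < length ys" "(U \<^bold>=\<^sub>1 ys ! n) q"
      unfolding value_iff by blast+
    show "(n \<^bold>\<in>\<^sub>0 check {..<length ys}) q"
      using n(1) unfolding forces_mem_check by simp
    have "(ys ! n \<^bold>\<in>\<^sub>1 \<F>) p"
      using ys n(1) by (intro into subsetD[OF ys] nth_mem)
    then have "(ys ! n \<^bold>\<in>\<^sub>1 \<F>) q"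
      by (rule regular_mono[OF regular_mem]) (rule order_trans[OF q rp])
    then show "(U \<^bold>\<in>\<^sub>1 \<F>) q"
      by (rule mem_cong_left[OF equality1 set_eq_sym[OF n(2)]])
  next
    fix n and q :: 'p assume "(n \<^bold>\<in>\<^sub>0 check {..<length ys}) q"
    then have "f_value1 f n (ys ! n) q"
      unfolding forces_mem_check value_iff using equality_refl[OF equality1] by simp
    then show "(\<^bold>\<exists>U. f_value1 f n U) q"
      by (rule forces_exI) (rule regular_value)
  next
    fix n U V q assume "(f_value1 f n U \<^bold>\<and> f_value1 f n V) q"
    then have "(U \<^bold>=\<^sub>1 ys ! n) q" "(V \<^bold>=\<^sub>1 ys ! n) q"
      unfolding forces_and value_iff by blast+
    then show "(U \<^bold>=\<^sub>1 V) q"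
      by (rule equality_trans[OF equality1 _ set_eq_sym])
  next
    fix m n U q assume q: "q \<le> r" and "(f_value1 f m U \<^bold>\<and> f_value1 f n U) q"
    then have m: "m < length ys" "(U \<^bold>=\<^sub>1 ys ! m) q" and n: "n < length ys" "(U \<^bold>=\<^sub>1 ys ! n) q"
      unfolding forces_and value_iff by blast+
    have "(ys ! m \<^bold>=\<^sub>1 ys ! n) q"
      using equality_trans[OF equality1 set_eq_sym[OF m(2)] n(2)] .
    then have "m = n"
      using distinct m(1) n(1) q unfolding f_not_def by blast
    then show "(m \<^bold>=\<^sub>0 n) q"
      unfolding f_check_eq_def .
  next
    fix U q assume q: "q \<le> r" and U: "(U \<^bold>\<in>\<^sub>1 \<F>) q"
    have regular_ex: "regular (\<^bold>\<exists>n. f_value1 f n U)"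
      by (intro regular_intros)
    show "(\<^bold>\<exists>n. f_value1 f n U) q"
    proof (rule regular_dense[OF regular_ex])
      fix q' assume q': "q' \<le> q"
      have "q' \<le> p"
        using q' q rp order_trans by blast
      then obtain t V where t: "t \<le> q'" "V \<in> G" "(U \<^bold>=\<^sub>1 V) t"
        using onto regular_mono[OF regular_mem U q'] by blast
      obtain i where i: "i < length ys" "(V \<^bold>=\<^sub>1 ys ! i) r"
        using rep t(2) by blast
      have "t \<le> r"
        using t(1) q' q order_trans by blast
      then have "(U \<^bold>=\<^sub>1 ys ! i) t"
        using equality_trans[OF equality1 t(3)] regular_mono[OF regular_set_eq i(2)] by blast
      then have "f_value1 f i U t"
        unfolding value_iff using i(1) by simp
      then have "(\<^bold>\<exists>n. f_value1 f n U) t"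
        by (rule forces_exI) (rule regular_value)
      then show "\<exists>t\<le>q'. (\<^bold>\<exists>n. f_value1 f n U) t"
        using t(1) by blast
    qed
  qed
  then have "(\<^bold>\<exists>f. f_enumerates f (length ys) \<F>) r"
    by (rule forces_exI) (unfold f_enumerates_def, intro regular_intros)
  then have "f_finite \<F> r"
    unfolding f_finite_def
    by (rule forces_exI) (unfold f_enumerates_def, intro regular_intros)
  then show "\<exists>r\<le>p'. f_finite \<F> r"
    using r by blast
qed

lemma mem_times_UNIV_I: "V \<in> G \<Longrightarrow> (V \<^bold>\<in>\<^sub>1 G \<times> UNIV) q"
  by (rule forces_memI[of V q]) (auto simp: equality_refl[OF equality1] regular_set_eq)

lemma mem_times_UNIV_D:
  assumes "(U \<^bold>\<in>\<^sub>1 G \<times> UNIV) q"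
  shows "\<exists>r\<le>q. \<exists>V\<in>G. (U \<^bold>=\<^sub>1 V) r"
  using forces_memD[OF assms order_refl] by blast

lemma family_cover_formula:
  defines "C \<equiv> (\<lambda>S U. \<^bold>\<exists>n. \<^bold>\<exists>\<F>. f_value2 S n \<F> \<^bold>\<and> U \<^bold>\<in>\<^sub>1 \<F>)"
  shows family_cover_regular: "regular (C S U)"
    and family_coverI: "f_value2 S n \<F> q \<Longrightarrow> (U \<^bold>\<in>\<^sub>1 \<F>) q \<Longrightarrow> C S U q"
    and family_coverD: "C S U q \<Longrightarrow> \<exists>r\<le>q. \<exists>n \<F>. f_value2 S n \<F> r \<and> (U \<^bold>\<in>\<^sub>1 \<F>) r"
proof -
  show "regular (C S U)"
    unfolding C_def by (intro regular_intros)
  show "C S U q" if "f_value2 S n \<F> q" "(U \<^bold>\<in>\<^sub>1 \<F>) q"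
  proof -
    have "(f_value2 S n \<F> \<^bold>\<and> U \<^bold>\<in>\<^sub>1 \<F>) q"
      using that by (rule forces_andI)
    then have "(\<^bold>\<exists>\<F>. f_value2 S n \<F> \<^bold>\<and> U \<^bold>\<in>\<^sub>1 \<F>) q"
      by (rule forces_exI) (intro regular_intros)
    then show ?thesis
      unfolding C_def by (rule forces_exI) (intro regular_intros)
  qed
  show "\<exists>r\<le>q. \<exists>n \<F>. f_value2 S n \<F> r \<and> (U \<^bold>\<in>\<^sub>1 \<F>) r" if C: "C S U q"
  proof -
    obtain r n where r: "r \<le> q" "(\<^bold>\<exists>\<F>. f_value2 S n \<F> \<^bold>\<and> U \<^bold>\<in>\<^sub>1 \<F>) r"
      using forces_exD[OF C[unfolded C_def] order_refl] by blast
    obtain t \<F> where "t \<le> r" "(f_value2 S n \<F> \<^bold>\<and> U \<^bold>\<in>\<^sub>1 \<F>) t"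
      using forces_exD[OF r(2) order_refl] by blast
    then show ?thesis
      using order_trans[OF _ r(1)] unfolding forces_and by blast
  qed
qed

text \<open>The selected finite family is treated one element at a time, by strengthening the condition to one
that either fixes a member of the cover containing that element or excludes that the element is ever
captured. In the second case nothing has to be chosen, so empty covers cause no difficulty.\<close>
lemma menger_forced:
  fixes X :: "'a topology"
  assumes endowed: "weakly_endowed TYPE('p::preorder)" and "menger X"
  shows "\<tturnstile> f_menger (check (topspace X) :: ('a, 'p) set_name) (generated_topology X)"
  unfolding forced_def f_menger_def
proof (intro allI forces_allI forces_impI)
  fix p\<^sub>0 p :: 'p and \<U> :: "(('a, 'p) family_name, 'p) seq_name"
  assume \<U>: "f_sequence_of_open_covers (check (topspace X)) (generated_topology X) \<U> p"
  obtain \<S> where fin: "\<forall>n. finite (\<S> n)"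
    and covers: "\<forall>q\<le>p. \<forall>x\<in>topspace X. \<exists>n. \<exists>W\<in>\<S> n. x \<in> W \<and> (\<exists>r\<le>q. captured \<U> n W r)"
    using captured_selection[OF endowed menger_selects[OF assms(2)] \<U>] by (elim exE conjE)
  define chosen where "chosen n G \<K> q \<longleftrightarrow> (\<exists>\<A>. f_value2 \<U> n \<A> q \<and> (\<forall>V\<in>G. (V \<^bold>\<in>\<^sub>1 \<A>) q)) \<and>
    (\<forall>W\<in>\<K>. \<forall>r\<le>q. captured \<U> n W r \<longrightarrow> (\<exists>V\<in>G. (check W \<^bold>\<subseteq> V) r))"
    for n and G :: "('a, 'p) set_name set" and \<K> q
  define \<phi> where "\<phi> n \<F> q \<longleftrightarrow> (\<exists>G. finite G \<and> \<F> = G \<times> UNIV \<and> chosen n G (\<S> n) q)"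
    for n and \<F> :: "('a, 'p) family_name" and q
  have chosen_mono: "chosen n G \<K> r" if "chosen n G \<K> q" "r \<le> q" for n G \<K> q r
  proof -
    have "\<exists>\<A>. f_value2 \<U> n \<A> r \<and> (\<forall>V\<in>G. (V \<^bold>\<in>\<^sub>1 \<A>) r)"
      using that(1) regular_mono[OF regular_value _ that(2)] regular_mono[OF regular_mem _ that(2)]
      unfolding chosen_def by meson
    moreover have "\<forall>W\<in>\<K>. \<forall>t\<le>r. captured \<U> n W t \<longrightarrow> (\<exists>V\<in>G. (check W \<^bold>\<subseteq> V) t)"
      using that(1) order_trans[OF _ that(2)] unfolding chosen_def by simp
    ultimately show ?thesis
      unfolding chosen_def by (rule conjI)
  qed
  have chosen_exists: "\<exists>r\<le>q. \<exists>G. finite G \<and> chosen n G \<K> r" if "finite \<K>" and q: "q \<le> p" for n \<K> q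
    using that(1)
  proof (induction \<K>)
    case empty
    obtain r \<A> where "r \<le> q" "f_value2 \<U> n \<A> r"
      using cover_exists[OF \<U> q] by blast
    then show ?case
      by (intro exI[of _ r] conjI exI[of _ "{}"]) (auto simp: chosen_def)
  next
    case (insert W \<K>)
    then obtain r G where r: "r \<le> q" and G: "finite G" "chosen n G \<K> r"
      by (elim exE conjE)
    show ?case
    proof (cases "\<exists>t\<le>r. captured \<U> n W t")
      case True
      then obtain t \<A> V where t: "t \<le> r"
        and V: "f_value2 \<U> n \<A> t" "(V \<^bold>\<in>\<^sub>1 \<A>) t" "(check W \<^bold>\<subseteq> V) t"
        unfolding captured_def by blast
      have tq: "t \<le> q"
        using t r by (rule order_trans)
      have Gt: "chosen n G \<K> t"
        using G(2) t by (rule chosen_mono)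
      then obtain \<B> where \<B>: "f_value2 \<U> n \<B> t" "\<forall>V\<in>G. (V \<^bold>\<in>\<^sub>1 \<B>) t"
        unfolding chosen_def by blast
      have "(V \<^bold>\<in>\<^sub>1 \<B>) t"
        using mem_cong_right[OF equality1
            cover_unique[OF \<U> order_trans[OF tq q] V(1) \<B>(1)] V(2)] .
      then have "\<exists>\<A>. f_value2 \<U> n \<A> t \<and> (\<forall>V\<in>insert V G. (V \<^bold>\<in>\<^sub>1 \<A>) t)"
        using \<B> by blast
      moreover have "\<exists>V\<in>insert V G. (check W' \<^bold>\<subseteq> V) s"
        if "W' \<in> insert W \<K>" "s \<le> t" "captured \<U> n W' s" for W' s
        using that Gt regular_mono[OF regular_subset V(3)] unfolding chosen_def by blast
      ultimately have "chosen n (insert V G) (insert W \<K>) t"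
        unfolding chosen_def by simp
      then show ?thesis
        using G(1) tq by (intro exI[of _ t] conjI exI[of _ "insert V G"]) auto
    next
      case False
      then have "chosen n G (insert W \<K>) r"
        using G(2) unfolding chosen_def by simp
      then show ?thesis
        using G(1) r by blast
    qed
  qed
  show "(\<^bold>\<exists>S. f_sequence f_eq2 S \<^bold>\<and>
      (\<^bold>\<forall>n. \<^bold>\<forall>\<A>. \<^bold>\<forall>\<F>. f_value2 \<U> n \<A> \<^bold>\<and> f_value2 S n \<F> \<^bold>\<longrightarrow> f_finite \<F> \<^bold>\<and> f_subfamily \<F> \<A>) \<^bold>\<and>
      f_open_cover (check (topspace X)) (generated_topology X)
        (\<lambda>U. \<^bold>\<exists>n. \<^bold>\<exists>\<F>. f_value2 S n \<F> \<^bold>\<and> U \<^bold>\<in>\<^sub>1 \<F>)) p"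
  proof (rule selection_forced[where M = f_mem1 and \<phi> = \<phi> and \<S> = \<S>
        and C = "\<lambda>S U. \<^bold>\<exists>n. \<^bold>\<exists>\<F>. f_value2 S n \<F> \<^bold>\<and> U \<^bold>\<in>\<^sub>1 \<F>"
        and G = "\<lambda>\<F> \<A>. f_finite \<F> \<^bold>\<and> f_subfamily \<F> \<A>", OF equality2])
    show "(U \<^bold>\<in>\<^sub>1 \<F>') q" if "(U \<^bold>\<in>\<^sub>1 \<F>) q" "(\<F> \<^bold>=\<^sub>2 \<F>') q" for U \<F> \<F>' and q :: 'p
      using mem_cong_right[OF equality1 that(2,1)] .
    show "\<phi> n \<F> r" if "\<phi> n \<F> q" "r \<le> q" for n \<F> q r
      using that(1) chosen_mono[OF _ that(2)] unfolding \<phi>_def by blast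
    show "\<exists>r\<le>q. \<exists>\<F>. \<phi> n \<F> r" if q: "q \<le> p" for n q
    proof -
      obtain r G where r: "r \<le> q" and G: "finite G" "chosen n G (\<S> n) r"
        using chosen_exists[OF spec[OF fin] q] by blast
      then have "\<phi> n (G \<times> UNIV) r"
        unfolding \<phi>_def by blast
      then show ?thesis
        using r by blast
    qed
    show "(f_finite \<F> \<^bold>\<and> f_subfamily \<F> \<A>) q"
      if q: "q \<le> p" and "\<phi> n \<F>' q" and eq: "(\<F> \<^bold>=\<^sub>2 \<F>') q" and \<A>: "f_value2 \<U> n \<A> q"
      for n \<F> \<F>' \<A> q
    proof -
      obtain G where G: "finite G" "\<F>' = G \<times> UNIV" "chosen n G (\<S> n) q"
        using \<open>\<phi> n \<F>' q\<close> unfolding \<phi>_def by blast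
      obtain \<B> where \<B>: "f_value2 \<U> n \<B> q" "\<forall>V\<in>G. (V \<^bold>\<in>\<^sub>1 \<B>) q"
        using G(3) unfolding chosen_def by blast
      have mem: "(V \<^bold>\<in>\<^sub>1 \<A>) q" if "V \<in> G" for V
        using mem_cong_right[OF equality1 cover_unique[OF \<U> q \<B>(1) \<A>]] \<B>(2) that by blast
      have into: "(V \<^bold>\<in>\<^sub>1 \<F>) q" if "V \<in> G" for V
        using mem_cong_right[OF equality1 set_eq_sym[OF eq]] mem_times_UNIV_I[OF that]
        unfolding G(2) by blast
      have onto: "\<exists>t\<le>r. \<exists>V\<in>G. (U \<^bold>=\<^sub>1 V) t" if "r \<le> q" "(U \<^bold>\<in>\<^sub>1 \<F>) r" for U r
        using mem_cong_right[OF equality1 regular_mono[OF regular_set_eq eq that(1)] that(2)]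
        unfolding G(2) by (rule mem_times_UNIV_D)
      have "f_finite \<F> q"
        using G(1) into onto by (rule finite_forcedI)
      moreover have "f_subfamily \<F> \<A> q"
        unfolding f_subfamily_def
      proof (intro forces_allI forces_impI regular_dense[OF regular_mem])
        fix U r r' assume r: "r \<le> q" and U: "(U \<^bold>\<in>\<^sub>1 \<F>) r" and r': "r' \<le> r"
        have r'q: "r' \<le> q"
          using r' r by (rule order_trans)
        obtain t V where t: "t \<le> r'" "V \<in> G" "(U \<^bold>=\<^sub>1 V) t"
          using onto[OF r'q regular_mono[OF regular_mem U r']] by blast
        have "(V \<^bold>\<in>\<^sub>1 \<A>) t"
          using regular_mono[OF regular_mem mem[OF t(2)] order_trans[OF t(1) r'q]] .
        then have "(U \<^bold>\<in>\<^sub>1 \<A>) t"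
          by (rule mem_cong_left[OF equality1 set_eq_sym[OF t(3)]])
        then show "\<exists>t\<le>r'. (U \<^bold>\<in>\<^sub>1 \<A>) t"
          using t(1) by blast
      qed
      ultimately show ?thesis
        by (rule forces_andI)
    qed
    show "(U \<^bold>\<in>\<^sub>1 generated_topology X) q"
      if q: "q \<le> p" and "\<phi> n \<F> q" and U: "(U \<^bold>\<in>\<^sub>1 \<F>) q" for n \<F> U q
    proof (rule regular_dense[OF regular_mem])
      obtain G \<B> where G: "\<F> = G \<times> UNIV" "f_value2 \<U> n \<B> q" "\<forall>V\<in>G. (V \<^bold>\<in>\<^sub>1 \<B>) q"
        using \<open>\<phi> n \<F> q\<close> unfolding \<phi>_def chosen_def by blast
      fix q' assume q': "q' \<le> q"
      obtain t V where t: "t \<le> q'" "V \<in> G" "(U \<^bold>=\<^sub>1 V) t"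
        using mem_times_UNIV_D[OF regular_mono[OF regular_mem U q', unfolded G(1)]] by blast
      have "(V \<^bold>\<in>\<^sub>1 generated_topology X) q"
        using cover_open[OF \<U> q G(2)] G(3) t(2) by blast
      then have "(V \<^bold>\<in>\<^sub>1 generated_topology X) t"
        by (rule regular_mono[OF regular_mem]) (rule order_trans[OF t(1) q'])
      then have "(U \<^bold>\<in>\<^sub>1 generated_topology X) t"
        by (rule mem_cong_left[OF equality1 set_eq_sym[OF t(3)]])
      then show "\<exists>t\<le>q'. (U \<^bold>\<in>\<^sub>1 generated_topology X) t"
        using t(1) by blast
    qed
    show "\<exists>V. (V \<^bold>\<in>\<^sub>1 \<F>) q \<and> (check W \<^bold>\<subseteq> V) q"
      if "\<phi> n \<F> q" "W \<in> \<S> n" "captured \<U> n W q" for n \<F> W q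
      using that mem_times_UNIV_I order_refl unfolding \<phi>_def chosen_def by blast
  qed (fact covers | rule family_coverI family_coverD family_cover_regular, assumption+ |
      intro regular_concept_intros)+
qed

section \<open>Selective screenability\<close>

text \<open>The \<open>n\<close>th family consists of those selected ground model sets that turn out to be captured. Its elements
are check names, so disjointness is inherited from the ground model, and being captured is exactly
what refinement requires.\<close>
lemma selectively_screenable_forced:
  fixes X :: "'a topology"
  assumes endowed: "weakly_endowed TYPE('p::preorder)" and "selectively_screenable X"
  shows "\<tturnstile> f_selectively_screenable (check (topspace X) :: ('a, 'p) set_name) (generated_topology X)"
  unfolding forced_def f_selectively_screenable_def
proof (intro allI forces_allI forces_impI)
  fix p\<^sub>0 p :: 'p and \<U> :: "(('a, 'p) family_name, 'p) seq_name"
  assume \<U>: "f_sequence_of_open_covers (check (topspace X)) (generated_topology X) \<U> p"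
  obtain \<S> where disjoint: "\<forall>n. pairwise disjnt (\<S> n)"
    and opn: "\<forall>n. \<forall>W\<in>\<S> n. openin X W"
    and covers: "\<forall>q\<le>p. \<forall>x\<in>topspace X. \<exists>n. \<exists>W\<in>\<S> n. x \<in> W \<and> (\<exists>r\<le>q. captured \<U> n W r)"
    using captured_selection[OF endowed selectively_screenable_selects[OF assms(2)] \<U>]
    by (elim exE conjE)
  define H :: "nat \<Rightarrow> ('a, 'p) family_name" where
    "H n = {(check W, s) | W s. W \<in> \<S> n \<and> captured \<U> n W s}" for n
  have H_D: "\<exists>t\<le>q. \<exists>W\<in>\<S> n. captured \<U> n W t \<and> (U \<^bold>=\<^sub>1 check W) t" if U: "(U \<^bold>\<in>\<^sub>1 H n) q" for U n q
  proof -
    obtain t V s where t: "t \<le> q" "(V, s) \<in> H n" "t \<le> s" "(U \<^bold>=\<^sub>1 V) t"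
      using forces_memD[OF U order_refl] by blast
    then obtain W where "V = check W" "W \<in> \<S> n" "captured \<U> n W s"
      unfolding H_def by blast
    then show ?thesis
      using t captured_mono by blast
  qed
  have H_open: "(U \<^bold>\<in>\<^sub>1 generated_topology X) q" if U: "(U \<^bold>\<in>\<^sub>1 H n) q" for U n q
  proof (rule regular_dense[OF regular_mem])
    fix q' assume q': "q' \<le> q"
    obtain t W where t: "t \<le> q'" "W \<in> \<S> n" "(U \<^bold>=\<^sub>1 check W) t"
      using H_D[OF regular_mono[OF regular_mem U q']] by blast
    have "(check W \<^bold>\<in>\<^sub>1 generated_topology X) t"
      using opn t(2) by (intro check_mem_generated_topology) blast
    then have "(U \<^bold>\<in>\<^sub>1 generated_topology X) t"
      by (rule mem_cong_left[OF equality1 set_eq_sym[OF t(3)]])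
    then show "\<exists>t\<le>q'. (U \<^bold>\<in>\<^sub>1 generated_topology X) t"
      using t(1) by blast
  qed
  show "(\<^bold>\<exists>S. f_sequence f_eq2 S \<^bold>\<and>
      (\<^bold>\<forall>n. \<^bold>\<forall>\<A>. \<^bold>\<forall>\<H>. f_value2 \<U> n \<A> \<^bold>\<and> f_value2 S n \<H> \<^bold>\<longrightarrow>
        f_subfamily \<H> (generated_topology X) \<^bold>\<and> f_pairwise_disjoint \<H> \<^bold>\<and> f_refines \<H> \<A>) \<^bold>\<and>
      f_open_cover (check (topspace X)) (generated_topology X)
        (\<lambda>U. \<^bold>\<exists>n. \<^bold>\<exists>\<H>. f_value2 S n \<H> \<^bold>\<and> U \<^bold>\<in>\<^sub>1 \<H>)) p"
  proof (rule selection_forced[where M = f_mem1 and \<phi> = "\<lambda>n \<H> _. \<H> = H n" and \<S> = \<S>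
        and C = "\<lambda>S U. \<^bold>\<exists>n. \<^bold>\<exists>\<F>. f_value2 S n \<F> \<^bold>\<and> U \<^bold>\<in>\<^sub>1 \<F>"
        and G = "\<lambda>\<H> \<A>. f_subfamily \<H> (generated_topology X) \<^bold>\<and> f_pairwise_disjoint \<H> \<^bold>\<and> f_refines \<H> \<A>",
        OF equality2])
    show "(U \<^bold>\<in>\<^sub>1 \<F>') q" if "(U \<^bold>\<in>\<^sub>1 \<F>) q" "(\<F> \<^bold>=\<^sub>2 \<F>') q" for U \<F> \<F>' and q :: 'p
      using mem_cong_right[OF equality1 that(2,1)] .
    show "\<exists>r\<le>q. \<exists>\<H>. \<H> = H n" for n and q :: 'p
      using order_refl by blast
    show "(U \<^bold>\<in>\<^sub>1 generated_topology X) q" if "z = H n" "(U \<^bold>\<in>\<^sub>1 z) q" for n z U q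
      using that H_open by blast
    show "\<exists>V. (V \<^bold>\<in>\<^sub>1 z) q \<and> (check W \<^bold>\<subseteq> V) q"
      if "z = H n" "W \<in> \<S> n" "captured \<U> n W q" for n z W q
    proof -
      have "(check W \<^bold>\<in>\<^sub>1 z) q"
        using that by (intro forces_memI[of "check W" q])
          (auto simp: H_def equality_refl[OF equality1] regular_set_eq)
      then show ?thesis
        using check_subset_check by blast
    qed
    show "(f_subfamily \<H> (generated_topology X) \<^bold>\<and> f_pairwise_disjoint \<H> \<^bold>\<and> f_refines \<H> \<A>) q"
      if q: "q \<le> p" and "z = H n" and "(\<H> \<^bold>=\<^sub>2 z) q" and \<A>: "f_value2 \<U> n \<A> q" for n \<H> z \<A> q
    proof -
      have in_H: "(U \<^bold>\<in>\<^sub>1 H n) r" if "(U \<^bold>\<in>\<^sub>1 \<H>) r" "r \<le> q" for U r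
        using mem_cong_right[OF equality1 regular_mono[OF regular_set_eq \<open>(\<H> \<^bold>=\<^sub>2 z) q\<close> that(2)] that(1)]
        unfolding \<open>z = H n\<close> .
      have "f_subfamily \<H> (generated_topology X) q"
        unfolding f_subfamily_def by (intro forces_allI forces_impI H_open[of _ n] in_H)
      moreover have "f_pairwise_disjoint \<H> q"
        unfolding f_pairwise_disjoint_def
      proof (intro forces_allI forces_impI)
        fix U V r assume r: "r \<le> q" and "(U \<^bold>\<in>\<^sub>1 \<H> \<^bold>\<and> V \<^bold>\<in>\<^sub>1 \<H> \<^bold>\<and> \<^bold>\<not> U \<^bold>=\<^sub>1 V) r"
        then have UV: "(U \<^bold>\<in>\<^sub>1 H n) r" "(V \<^bold>\<in>\<^sub>1 H n) r" "(\<^bold>\<not> U \<^bold>=\<^sub>1 V) r"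
          using in_H unfolding forces_and by blast+
        show "(\<^bold>\<not> (\<^bold>\<exists>x. x \<^bold>\<in>\<^sub>0 U \<^bold>\<and> x \<^bold>\<in>\<^sub>0 V)) r"
          unfolding f_not_def[of "\<^bold>\<exists>x. x \<^bold>\<in>\<^sub>0 U \<^bold>\<and> x \<^bold>\<in>\<^sub>0 V"]
        proof (intro allI impI notI)
          fix s assume s: "s \<le> r" and "(\<^bold>\<exists>x. x \<^bold>\<in>\<^sub>0 U \<^bold>\<and> x \<^bold>\<in>\<^sub>0 V) s"
          then obtain t x where t: "t \<le> s" and x: "(x \<^bold>\<in>\<^sub>0 U) t" "(x \<^bold>\<in>\<^sub>0 V) t"
            using forces_exD[OF _ order_refl] unfolding forces_and by blast
          have tr: "t \<le> r"
            using t s by (rule order_trans)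
          \<comment> \<open>Two elements that are not equal and share the point \<open>x\<close> would be decided to be two check
            names of selected sets containing \<open>x\<close>, hence of the same set.\<close>
          obtain t1 W1 where t1: "t1 \<le> t" "W1 \<in> \<S> n" "(U \<^bold>=\<^sub>1 check W1) t1"
            using H_D[OF regular_mono[OF regular_mem UV(1) tr]] by blast
          have t1r: "t1 \<le> r"
            using t1(1) tr by (rule order_trans)
          obtain t2 W2 where t2: "t2 \<le> t1" "W2 \<in> \<S> n" "(V \<^bold>=\<^sub>1 check W2) t2"
            using H_D[OF regular_mono[OF regular_mem UV(2) t1r]] by blast
          have t2t: "t2 \<le> t"
            using t2(1) t1(1) by (rule order_trans)
          have U2: "(U \<^bold>=\<^sub>1 check W1) t2"
            using regular_mono[OF regular_set_eq t1(3) t2(1)] .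
          have "x \<in> W1"
            using mem_cong_right[OF equality_check_eq U2 regular_mono[OF regular_mem x(1) t2t]]
            unfolding forces_mem_check .
          moreover have "x \<in> W2"
            using mem_cong_right[OF equality_check_eq t2(3) regular_mono[OF regular_mem x(2) t2t]]
            unfolding forces_mem_check .
          ultimately have "W1 = W2"
            using disjoint t1(2) t2(2) by (metis pairwiseD disjnt_iff)
          then have "(U \<^bold>=\<^sub>1 V) t2"
            using equality_trans[OF equality1 U2] set_eq_sym[OF t2(3)] by blast
          moreover have "t2 \<le> r"
            using t2(1) t1r by (rule order_trans)
          ultimately show False
            using UV(3) unfolding f_not_def by blast
        qed
      qed
      moreover have "f_refines \<H> \<A> q"
        unfolding f_refines_def
      proof (intro forces_allI forces_impI)
        fix U r assume r: "r \<le> q" and U: "(U \<^bold>\<in>\<^sub>1 \<H>) r"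
        have regular_ex: "regular (\<^bold>\<exists>V. V \<^bold>\<in>\<^sub>1 \<A> \<^bold>\<and> U \<^bold>\<subseteq> V)"
          by (intro regular_intros)
        show "(\<^bold>\<exists>V. V \<^bold>\<in>\<^sub>1 \<A> \<^bold>\<and> U \<^bold>\<subseteq> V) r"
        proof (rule regular_dense[OF regular_ex])
          fix r' assume r': "r' \<le> r"
          obtain t W where t: "t \<le> r'" "captured \<U> n W t" "(U \<^bold>=\<^sub>1 check W) t"
            using H_D[OF regular_mono[OF regular_mem in_H[OF U r] r']] by blast
          then obtain \<B> V where \<B>: "f_value2 \<U> n \<B> t" "(V \<^bold>\<in>\<^sub>1 \<B>) t" "(check W \<^bold>\<subseteq> V) t"
            unfolding captured_def by blast
          have tq: "t \<le> q"
            using t(1) r' r order_trans by blast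
          have "(V \<^bold>\<in>\<^sub>1 \<A>) t"
            using mem_cong_right[OF equality1 cover_unique[OF \<U> order_trans[OF tq q] \<B>(1)
                  regular_mono[OF regular_value \<A> tq]] \<B>(2)] .
          moreover have "(U \<^bold>\<subseteq> V) t"
            using subset_cong_left[OF \<B>(3) set_eq_sym[OF t(3)]] .
          ultimately have "(V \<^bold>\<in>\<^sub>1 \<A> \<^bold>\<and> U \<^bold>\<subseteq> V) t"
            by (rule forces_andI)
          then have "(\<^bold>\<exists>V. V \<^bold>\<in>\<^sub>1 \<A> \<^bold>\<and> U \<^bold>\<subseteq> V) t"
            by (rule forces_exI) (intro regular_intros)
          then show "\<exists>t\<le>r'. (\<^bold>\<exists>V. V \<^bold>\<in>\<^sub>1 \<A> \<^bold>\<and> U \<^bold>\<subseteq> V) t"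
            using t(1) by blast
        qed
      qed
      ultimately show ?thesis
        by (intro forces_andI)
    qed
  qed (fact covers | rule family_coverI family_coverD family_cover_regular, assumption+ |
      assumption | intro regular_concept_intros)+
qed

section \<open>Preservation by weakly endowed forcing\<close>

theorem theorem3p2:
  fixes X :: "'a topology"
  assumes "weakly_endowed TYPE('p::preorder)"
  shows "(rothberger X \<longrightarrow>
            (\<tturnstile> f_rothberger (check (topspace X) :: ('a, 'p) set_name) (generated_topology X))) \<and>
         (menger X \<longrightarrow>
            (\<tturnstile> f_menger (check (topspace X) :: ('a, 'p) set_name) (generated_topology X))) \<and>
         (selectively_screenable X \<longrightarrow>
            (\<tturnstile> f_selectively_screenable (check (topspace X) :: ('a, 'p) set_name) (generated_topology X)))"
  using rothberger_forced[OF assms] menger_forced[OF assms] selectively_screenable_forced[OF assms]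
  by blast

end
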